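(* Let $\mathcal{F}$ be a family of pairs $(f,g)$ of non-negative measurable functions on $\mathbb{R}^n$. Suppose that for some $p_0>0$ and every $w_0\in A_1$, $$\int_{\mathbb{R}^n}f(x)^{p_0}w_0(x)\,dx\le C\int_{\mathbb{R}^n}g(x)^{p_0}w_0(x)\,dx,\qquad(f,g)\in\mathcal{F}.$$ Given $p(\cdot)\in\mathcal{P}_0$ such that $p_-\ge p_0$, suppose that $w$ is a weight with $w^{p_0}\in A_{p(\cdot)/p_0}$ and that the maximal operator $M$ is bounded on $L^{(p(\cdot)/p_0)'}(w^{-p_0})$. Then $$\|f\|_{L^{p(\cdot)}(w)}\le C\|g\|_{L^{p(\cdot)}(w)},\qquad(f,g)\in\mathcal{F}.$$
   Context: $\mathcal{P}$ is the set of measurable $p(\cdot):\mathbb{R}^n\to[1,\infty]$; $\mathcal{P}_0$ is the set of measurable $p(\cdot):\mathbb{R}^n\to(0,\infty)$; $p_-=\operatorname{ess\,inf}p$. For $p(\cdot)\in\mathcal{P}$ the conjugate exponent $p'(\cdot)$ is defined pointwise by $1/p(x)+1/p'(x)=1$, $1/\infty=0$. For $p(\cdot)\in\mathcal{P}$ or $\mathcal{P}_0$, with $\mathbb{R}^n_\infty=\{x:p(x)=\infty\}$, $$\|f\|_{p(\cdot)}=\inf\Big\{\lambda>0:\int_{\mathbb{R}^n\setminus\mathbb{R}^n_\infty}\Big(\frac{|f(x)|}{\lambda}\Big)^{p(x)}dx+\lambda^{-1}\|f\|_{L^\infty(\mathbb{R}^n_\infty)}\le1\Big\}$$ (a quasi-norm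 in general for $\mathcal{P}_0$). A weight is a non-negative measurable function; $\|f\|_{L^{p(\cdot)}(w)}:=\|fw\|_{p(\cdot)}$, and $L^{p(\cdot)}(w)$ is the set of measurable $f$ for which this is finite. For $r(\cdot)\in\mathcal{P}$, $w\in A_{r(\cdot)}$ iff $0<w<\infty$ a.e. and $\sup_B|B|^{-1}\|w\chi_B\|_{r(\cdot)}\|w^{-1}\chi_B\|_{r'(\cdot)}<\infty$. $Mf(x)=\sup_{B\ni x}\frac1{|B|}\int_B|f(y)|\,dy$; $M$ is bounded on $L^{r(\cdot)}(v)$ if $\|(Mf)v\|_{r(\cdot)}\le C\|fv\|_{r(\cdot)}$ for all $f\in L^{r(\cdot)}(v)$. Classical $A_1$: $w_0\in A_1$ iff $\sup_B\frac{|B|^{-1}\int_Bw_0}{\operatorname{ess\,inf}_Bw_0}<\infty$. Suprema are over balls in $\mathbb{R}^n$. Convention: an inequality over $(f,g)\in\mathcal{F}$ (norm or weighted integral) means that it holds, with constant independent of the pair, for every pair $(f,g)\in\mathcal{F}$ for which the left-hand side is finite. *)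

theory Defs
  imports "HOL-Analysis.Analysis" "HOL-Probability.Essential_Supremum"
begin

text \<open>
  Measurable means Lebesgue measurable. Weights, exponents and non-negative functions take
  values in \<open>ennreal\<close>, since exponents, weights and maximal functions may be infinite.
\<close>

text \<open>The power \<open>x\<^sup>a\<close> on \<open>[0,\<infinity>]\<close>; it is only meaningful (and only used) for exponents \<open>a > 0\<close>.\<close>

definition epow :: "ennreal \<Rightarrow> real \<Rightarrow> ennreal" where
  "epow x a = (if x = \<infinity> then \<infinity> else ennreal (enn2real x powr a))"

definition essinf :: "'a measure \<Rightarrow> ('a \<Rightarrow> ennreal) \<Rightarrow> ennreal" where
  "essinf M f = Liminf (ae_filter M) f"

lemma essinf_eq_AE: "essinf M f = Sup {z. AE x in M. z \<le> f x}"
  unfolding essinf_def Liminf_def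
proof (intro antisym SUP_least Sup_least; clarsimp)
  fix P assume P: "AE x in M. P x"
  show "(INF x\<in>Collect P. f x) \<le> Sup {z. AE x in M. z \<le> f x}"
  proof (rule Sup_upper; clarsimp)
    show "AE x in M. (INF x\<in>Collect P. f x) \<le> f x"
      using P by (auto elim: eventually_mono simp: INF_lower)
  qed
next
  fix y assume "AE x in M. y \<le> f x"
  then have "(\<lambda>x. y \<le> f x) \<in> {P. AE x in M. P x}"
    by simp
  then show "y \<le> (SUP P\<in>{P. AE x in M. P x}. INF x\<in>Collect P. f x)"
    by (rule SUP_upper2) (auto intro: INF_greatest)
qed

definition balls :: "(real^'n) set set" where
  "balls = {ball c r | c r. 0 < r}"


section \<open>Variable exponents\<close>

definition exponents :: "(real^'n \<Rightarrow> ennreal) set" where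
  "exponents = {p \<in> borel_measurable lebesgue. \<forall>x. 1 \<le> p x}"

definition exponents0 :: "(real^'n \<Rightarrow> ennreal) set" where
  "exponents0 = {p \<in> borel_measurable lebesgue. \<forall>x. 0 < p x \<and> p x < \<infinity>}"

text \<open>
  \<open>1/r + 1/r' = 1\<close> with \<open>1/\<infinity> = 0\<close>, where \<open>inverse 0 = \<infinity>\<close> and \<open>inverse \<infinity> = 0\<close> in \<open>ennreal\<close>.
  An exponent that is only \<open>\<ge> 1\<close> almost everywhere gets the value \<open>\<infinity>\<close> on the exceptional null
  set, to which the norms below are insensitive.
\<close>

definition conj_exponent :: "(real^'n \<Rightarrow> ennreal) \<Rightarrow> real^'n \<Rightarrow> ennreal" where
  "conj_exponent r x = inverse (1 - inverse (r x))"

lemma conj_exponent: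
  assumes "r \<in> exponents"
  shows "inverse (r x) + inverse (conj_exponent r x) = 1"
proof -
  have "inverse (r x) \<le> 1"
  proof (cases "r x")
    case (real t)
    then have "1 \<le> t"
      using assms by (metis (mono_tags, lifting) exponents_def mem_Collect_eq ennreal_ge_1)
    then show ?thesis
      using real by (simp add: inverse_ennreal inverse_le_1_iff)
  qed simp
  then have "inverse (r x) + (1 - inverse (r x)) = 1"
    by (simp add: add_diff_inverse_ennreal)
  moreover have "inverse (inverse y) = y" for y :: ennreal
  proof (cases "y = 0 \<or> y = \<infinity>")
    case False
    then obtain t where "0 < t" "y = ennreal t"
      by (cases y) (auto simp: less_le)
    then show ?thesis
      by (simp add: inverse_ennreal)
  qed auto
  ultimately show ?thesis
    by (simp add: conj_exponent_def)
qed

text \<open>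
  The norm depends only on \<open>|f|\<close>, so it is defined on \<open>[0,\<infinity>]\<close>-valued functions. It is \<open>\<infinity>\<close> if no
  \<open>t\<close> is admissible.
\<close>

definition vnorm :: "(real^'n \<Rightarrow> ennreal) \<Rightarrow> (real^'n \<Rightarrow> ennreal) \<Rightarrow> ennreal" where
  "vnorm p f = Inf {ennreal t | t. 0 < t \<and>
     (\<integral>\<^sup>+x\<in>{x. p x \<noteq> \<infinity>}. epow (f x / ennreal t) (enn2real (p x)) \<partial>lebesgue)
       + esssup (restrict_space lebesgue {x. p x = \<infinity>}) f / ennreal t \<le> 1}"

definition wnorm :: "(real^'n \<Rightarrow> ennreal) \<Rightarrow> (real^'n \<Rightarrow> ennreal) \<Rightarrow> (real^'n \<Rightarrow> ennreal) \<Rightarrow> ennreal" where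
  "wnorm p w f = vnorm p (\<lambda>x. f x * w x)"

definition Lp_space :: "(real^'n \<Rightarrow> ennreal) \<Rightarrow> (real^'n \<Rightarrow> ennreal) \<Rightarrow> (real^'n \<Rightarrow> real) set" where
  "Lp_space p w = {f \<in> borel_measurable lebesgue. wnorm p w (\<lambda>x. ennreal \<bar>f x\<bar>) < \<infinity>}"


section \<open>Weights and the maximal operator\<close>

text \<open>The exponent is meant to be (almost everywhere) at least \<open>1\<close>.\<close>

definition A_weights :: "(real^'n \<Rightarrow> ennreal) \<Rightarrow> (real^'n \<Rightarrow> ennreal) set" where
  "A_weights r = {w \<in> borel_measurable lebesgue.
     (AE x in lebesgue. 0 < w x \<and> w x < \<infinity>) \<and>
     (SUP B\<in>balls. vnorm r (\<lambda>x. w x * indicator B x)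
        * vnorm (conj_exponent r) (\<lambda>x. inverse (w x) * indicator B x)
        / emeasure lebesgue B) < \<infinity>}"

text \<open>
  Here \<open>0/0 = \<infinity>/\<infinity> = 0\<close>, so besides the usual weights only functions that are almost everywhere \<open>0\<close>
  or almost everywhere \<open>\<infinity>\<close> belong to this class; weighted inequalities
  \<open>\<integral> f w \<le> C \<integral> g w\<close> with finite left-hand side are trivially true for these.
\<close>

definition A1_weights :: "(real^'n \<Rightarrow> ennreal) set" where
  "A1_weights = {w \<in> borel_measurable lebesgue.
     (SUP B\<in>balls. ((\<integral>\<^sup>+x\<in>B. w x \<partial>lebesgue) / emeasure lebesgue B)
        / essinf (restrict_space lebesgue B) w) < \<infinity>}"

definition maximal :: "(real^'n \<Rightarrow> real) \<Rightarrow> real^'n \<Rightarrow> ennreal" where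
  "maximal f x = (SUP B\<in>{B \<in> balls. x \<in> B}.
     (\<integral>\<^sup>+y\<in>B. ennreal \<bar>f y\<bar> \<partial>lebesgue) / emeasure lebesgue B)"

definition maximal_bounded_on :: "(real^'n \<Rightarrow> ennreal) \<Rightarrow> (real^'n \<Rightarrow> ennreal) \<Rightarrow> bool" where
  "maximal_bounded_on r v \<longleftrightarrow> (\<exists>C>0. \<forall>f\<in>Lp_space r v.
     wnorm r v (maximal f) \<le> ennreal C * wnorm r v (\<lambda>x. ennreal \<bar>f x\<bar>))"

end

theory Submission
  imports Defs
begin

text \<open>
  Raising everything to the power \<open>p0\<close> replaces the exponent \<open>p\<close> by \<open>q = p/p0 \<ge> 1\<close>, the weight by
  \<open>W = w\<^bsup>p0\<^esup>\<close> and the exponent in the hypothesis by \<open>1\<close> (\<open>vnorm_epow_less_iff\<close>). The norm of \<open>f W\<close> is then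
  recovered, up to a constant, from the integrals \<open>\<integral> f h\<close> where \<open>h / W\<close> runs through the unit ball for the
  conjugate exponent \<open>q'\<close> (\<open>vnorm_Hoelder\<close>, \<open>vnorm_dual_function\<close>).

  Such an \<open>h\<close> is not an \<open>A\<^sub>1\<close> weight, but it has an \<open>A\<^sub>1\<close> majorant of comparable norm, since the
  maximal operator \<open>M\<close> is bounded on the space with exponent \<open>q'\<close> and weight \<open>1/W\<close>: the
  Rubio de Francia series \<open>H = \<Sum>\<^sub>k M\<^sup>k h / (2C)\<^sup>k\<close> (\<open>Rubio_de_Francia_majorant\<close>). Hence
  \<open>\<integral> f h \<le> \<integral> f H \<le> C \<integral> g H\<close>, and Hoelder's inequality bounds the last integral by the norm of \<open>g W\<close>.

  The constant in the middle inequality may depend on \<open>H\<close>, hence on the pair \<open>(f, g)\<close>. To get a constant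
  for all pairs, the proof is by contradiction with a gliding hump: functions \<open>h\<^sub>k\<close> for a sequence of
  worse and worse pairs are summed with weights \<open>2\<^sup>-\<^sup>k\<close>, and the majorant of this single sum is tested against
  all the pairs (\<open>extrapolation_from_A1\<close>). Summing infinitely many functions, here and in the series \<open>H\<close>,
  rests on countable subadditivity of the norm (\<open>vnorm_suminf_le\<close>), that is, on Jensen's inequality.
\<close>

section \<open>Powers in the extended half-line\<close>

lemma epow_infty [simp]: "epow \<infinity> a = \<infinity>" "epow top a = \<infinity>"
  by (auto simp: epow_def)

lemma epow_ennreal: "0 \<le> t \<Longrightarrow> epow (ennreal t) a = ennreal (t powr a)"
  by (simp add: epow_def)

lemma epow_0 [simp]: "epow 0 a = 0"
  by (simp add: epow_def)

lemma epow_mono: "x \<le> y \<Longrightarrow> 0 \<le> a \<Longrightarrow> epow x a \<le> epow y a"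
  by (auto simp: epow_def top_unique less_top intro!: ennreal_leI powr_mono2 enn2real_mono)

lemma epow_eq_infty_iff: "epow x a = \<infinity> \<longleftrightarrow> x = \<infinity>"
  by (auto simp: epow_def)

lemma epow_mult: "0 < a \<Longrightarrow> epow (x * y) a = epow x a * epow y a"
proof -
  assume a: "0 < a"
  have z: "epow z a = 0 \<longleftrightarrow> z = 0" for z
    by (cases z) (auto simp: epow_def)
  show ?thesis
  proof (cases "x = \<infinity> \<or> y = \<infinity>")
    case True
    then show ?thesis
      by (auto simp: ennreal_mult_top ennreal_top_mult z)
  next
    case False
    then show ?thesis
      by (auto simp: epow_def enn2real_mult powr_mult ennreal_mult ennreal_mult_eq_top_iff)
  qed
qed

lemma epow_epow: "epow (epow x a) b = epow x (a * b)"
  by (auto simp: epow_def powr_powr)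

lemma borel_measurable_epow [measurable (raw)]:
  assumes [measurable]: "f \<in> borel_measurable M" "a \<in> borel_measurable M"
  shows "(\<lambda>x. epow (f x) (a x)) \<in> borel_measurable M"
  unfolding epow_def by measurable

lemma conj_exponent_measurable [measurable (raw)]:
  assumes [measurable]: "r \<in> borel_measurable lebesgue"
  shows "conj_exponent r \<in> borel_measurable lebesgue"
  unfolding conj_exponent_def by measurable

text \<open>
  The tangent to \<open>t\<^sup>r\<close> at \<open>s\<close> lies below the graph. This is Young's inequality for
  \<open>t \<cdot> s\<^sup>r\<^sup>-\<^sup>1\<close>. The form without subtraction carries over to \<open>[0,\<infinity>]\<close>.
\<close>

lemma powr_tangent:
  fixes s t r :: real
  assumes "0 < s" "0 \<le> t" "1 \<le> r"
  shows "s powr r + r * s powr (r - 1) * t \<le> t powr r + r * s powr r"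
proof (cases "r = 1")
  case False
  then have r: "1 < r" using assms by simp
  have "t * s powr (r - 1) \<le> t powr r / r + (s powr (r - 1)) powr (r / (r - 1)) / (r / (r - 1))"
    by (rule Youngs_inequality) (use assms r in \<open>auto simp: field_simps\<close>)
  also have "(s powr (r - 1)) powr (r / (r - 1)) = s powr r"
    using r by (simp add: powr_powr)
  finally have "r * (t * s powr (r - 1)) \<le> r * (t powr r / r + s powr r / (r / (r - 1)))"
    using r by (intro mult_left_mono) auto
  also have "\<dots> = t powr r + (r - 1) * s powr r"
    using r by (simp add: field_simps)
  finally show ?thesis
    by (simp add: algebra_simps)
qed (use assms in auto)

lemma ennreal_le_1_add_epow:
  assumes "1 \<le> r" shows "x \<le> 1 + epow x r"
proof (cases x)
  case (real t)
  have "t \<le> 1 + t powr r"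
  proof (cases "1 \<le> t")
    case True
    then have "t powr 1 \<le> t powr r" using assms by (intro powr_mono) auto
    then show ?thesis using True by simp
  qed (smt (verit) powr_ge_zero)
  then have "ennreal t \<le> ennreal (1 + t powr r)" by (rule ennreal_leI)
  then show ?thesis
    using real by (simp add: epow_ennreal)
qed simp

text \<open>
  Jensen's inequality for countable convex combinations: at a finite value \<open>s\<close> of the combination
  the tangent at \<open>s\<close> is averaged; if the value is infinite, so is the right-hand side.
\<close>

lemma epow_suminf_le:
  fixes \<theta> t :: "nat \<Rightarrow> ennreal"
  assumes \<theta>: "(\<Sum>k. \<theta> k) = 1" and r: "1 \<le> r"
  shows "epow (\<Sum>k. \<theta> k * t k) r \<le> (\<Sum>k. \<theta> k * epow (t k) r)"
proof (cases "\<Sum>k. \<theta> k * t k")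
  case (real s)
  show ?thesis
  proof (cases "s = 0")
    case False
    then have s: "0 < s" using real by simp
    let ?A = "ennreal (s powr r)" and ?B = "ennreal (r * s powr (r - 1))" and ?D = "ennreal (r * s powr r)"
    have "?A + ?B * t k \<le> epow (t k) r + ?D" for k
    proof (cases "t k")
      case (real u)
      have "ennreal (s powr r + r * s powr (r - 1) * u) \<le> ennreal (u powr r + r * s powr r)"
        by (intro ennreal_leI powr_tangent s real r)
      then show ?thesis
        using real r by (simp add: epow_ennreal ennreal_mult)
    qed simp
    then have "\<theta> k * (?A + ?B * t k) \<le> \<theta> k * (epow (t k) r + ?D)" for k
      by (intro mult_left_mono) auto
    then have "(\<Sum>k. \<theta> k * (?A + ?B * t k)) \<le> (\<Sum>k. \<theta> k * (epow (t k) r + ?D))"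
      by (intro suminf_le) auto
    moreover have "(\<Sum>k. \<theta> k * (?A + ?B * t k)) = ?A + ?B * ennreal s"
    proof -
      have "(\<Sum>k. \<theta> k * (?A + ?B * t k)) = (\<Sum>k. \<theta> k * ?A + ?B * (\<theta> k * t k))"
        by (simp add: distrib_left mult_ac)
      also have "\<dots> = (\<Sum>k. \<theta> k) * ?A + ?B * (\<Sum>k. \<theta> k * t k)"
        by (subst suminf_add[symmetric]) auto
      finally show ?thesis using \<theta> real by simp
    qed
    moreover have "(\<Sum>k. \<theta> k * (epow (t k) r + ?D)) = (\<Sum>k. \<theta> k * epow (t k) r) + ?D"
    proof -
      have "(\<Sum>k. \<theta> k * (epow (t k) r + ?D)) = (\<Sum>k. \<theta> k * epow (t k) r + \<theta> k * ?D)"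
        by (simp add: distrib_left)
      also have "\<dots> = (\<Sum>k. \<theta> k * epow (t k) r) + (\<Sum>k. \<theta> k) * ?D"
        by (subst suminf_add[symmetric]) auto
      finally show ?thesis using \<theta> by simp
    qed
    moreover have "?B * ennreal s = ?D"
      using s r by (simp add: ennreal_mult[symmetric] powr_diff)
    ultimately have "?A \<le> (\<Sum>k. \<theta> k * epow (t k) r)"
      by (simp add: add.commute)
    then show ?thesis using s real by (simp add: epow_ennreal)
  qed (use real in simp)
next
  case top
  have "(\<Sum>k. \<theta> k * t k) \<le> (\<Sum>k. \<theta> k + \<theta> k * epow (t k) r)"
    using mult_left_mono[OF ennreal_le_1_add_epow[OF r]] by (intro suminf_le) (auto simp: distrib_left)
  also have "\<dots> = 1 + (\<Sum>k. \<theta> k * epow (t k) r)"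
    using \<theta> by (subst suminf_add[symmetric]) auto
  finally show ?thesis using top by (simp add: top_unique)
qed

text \<open>
  Young's inequality with its constants \<open>1/r\<close> and \<open>1/s\<close> replaced by \<open>1\<close>, at the cost of a factor \<open>2\<close>
  in Hoelder's inequality: with a variable exponent the constants would sit inside the integral.
\<close>

lemma epow_Young:
  assumes "1 < r" "1 < s" "1 / r + 1 / s = 1"
  shows "x * y \<le> epow x r + epow y s"
proof (cases "x = \<infinity> \<or> y = \<infinity>")
  case True
  then show ?thesis by auto
next
  case False
  then obtain a b where ab: "0 \<le> a" "0 \<le> b" "x = ennreal a" "y = ennreal b"
    by (cases x; cases y) auto
  have "a * b \<le> a powr r / r + b powr s / s"
    by (rule Youngs_inequality) (use assms ab in auto)
  also have "\<dots> \<le> a powr r + b powr s"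
    using assms by (intro add_mono) (simp_all add: divide_le_eq mult_le_cancel_left1)
  finally have "ennreal (a * b) \<le> ennreal (a powr r + b powr s)" by (rule ennreal_leI)
  then show ?thesis using ab by (simp add: epow_ennreal ennreal_mult)
qed

section \<open>The modular and its norm\<close>

lemma ennreal_mult_inverse_self: "0 < y \<Longrightarrow> y < \<infinity> \<Longrightarrow> y * inverse y = 1" for y :: ennreal
  using ennreal_divide_self[of y] by (simp add: divide_ennreal_def)

lemma ennreal_divide_le_iff:
  fixes x c :: ennreal assumes "0 < t" shows "x / ennreal t \<le> c \<longleftrightarrow> x \<le> c * ennreal t"
proof
  assume "x / ennreal t \<le> c"
  then have "x / ennreal t * ennreal t \<le> c * ennreal t" by (intro mult_right_mono) auto
  moreover have "x / ennreal t * ennreal t = x"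
    using assms by (simp add: ennreal_divide_times ennreal_divide_self)
  ultimately show "x \<le> c * ennreal t" by simp
next
  assume "x \<le> c * ennreal t"
  then have "x / ennreal t \<le> c * ennreal t / ennreal t" by (rule divide_right_mono_ennreal)
  also have "\<dots> = c"
    using assms by (simp add: mult_divide_eq_ennreal)
  finally show "x / ennreal t \<le> c" .
qed

lemma esssup_restrict_le_iff:
  assumes "f \<in> borel_measurable M" "S \<in> sets M"
  shows "esssup (restrict_space M S) f \<le> c \<longleftrightarrow> (AE x in M. x \<in> S \<longrightarrow> f x \<le> c)"
proof -
  have "esssup (restrict_space M S) f \<le> c \<longleftrightarrow> (AE x in restrict_space M S. f x \<le> c)"
    using esssup_AE[of f "restrict_space M S"] assms
    by (auto intro!: esssup_I measurable_restrict_space1 elim!: eventually_mono)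
  also have "\<dots> \<longleftrightarrow> (AE x in M. x \<in> S \<longrightarrow> f x \<le> c)"
    using assms by (intro AE_restrict_space_iff) (auto intro: sets.Int)
  finally show ?thesis .
qed

text \<open>
  The functional whose unit sublevel set defines the norm. Unlike in \<open>vnorm\<close>, the scaling by \<open>t\<close> is left
  to the argument of the essential supremum, so that the modular is a convex function of one argument.
\<close>

definition modular :: "(real^'n \<Rightarrow> ennreal) \<Rightarrow> (real^'n \<Rightarrow> ennreal) \<Rightarrow> ennreal" where
  "modular r f = (\<integral>\<^sup>+x\<in>{x. r x \<noteq> \<infinity>}. epow (f x) (enn2real (r x)) \<partial>lebesgue)
     + esssup (restrict_space lebesgue {x. r x = \<infinity>}) f"

lemma sets_exponent_eq_infty:
  fixes r :: "real^'n \<Rightarrow> ennreal"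
  assumes "r \<in> borel_measurable lebesgue"
  shows "{x. r x = \<infinity>} \<in> sets lebesgue" "{x. r x \<noteq> \<infinity>} \<in> sets lebesgue"
proof -
  have "{x \<in> space lebesgue. r x = \<infinity>} \<in> sets lebesgue" "{x \<in> space lebesgue. r x \<noteq> \<infinity>} \<in> sets lebesgue"
    using assms by measurable
  then show "{x. r x = \<infinity>} \<in> sets lebesgue" "{x. r x \<noteq> \<infinity>} \<in> sets lebesgue" by simp_all
qed

lemma modular_finite_exponent:
  assumes "\<And>x. r x < \<infinity>" "f \<in> borel_measurable lebesgue"
  shows "modular r f = (\<integral>\<^sup>+x. epow (f x) (enn2real (r x)) \<partial>lebesgue)"
proof -
  have r: "r x \<noteq> top" for x using assms(1)[of x] by simp
  have "esssup (restrict_space lebesgue {x. r x = \<infinity>}) f \<le> 0"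
    using assms(2) r by (subst esssup_restrict_le_iff) auto
  then show ?thesis by (simp add: modular_def r)
qed

lemma modular_AE_mono:
  assumes "f \<in> borel_measurable lebesgue" "g \<in> borel_measurable lebesgue"
    and r: "r \<in> borel_measurable lebesgue" and le: "AE x in lebesgue. f x \<le> g x"
  shows "modular r f \<le> modular r g"
  unfolding modular_def
proof (intro add_mono)
  show "(\<integral>\<^sup>+x\<in>{x. r x \<noteq> \<infinity>}. epow (f x) (enn2real (r x)) \<partial>lebesgue)
    \<le> (\<integral>\<^sup>+x\<in>{x. r x \<noteq> \<infinity>}. epow (g x) (enn2real (r x)) \<partial>lebesgue)"
    using le by (intro nn_integral_mono_AE) (auto elim!: eventually_mono intro!: mult_right_mono epow_mono)
  show "esssup (restrict_space lebesgue {x. r x = \<infinity>}) f \<le> esssup (restrict_space lebesgue {x. r x = \<infinity>}) g"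
    using le assms sets_exponent_eq_infty[OF r]
    by (intro esssup_AE_mono measurable_restrict_space1)
       (auto simp: AE_restrict_space_iff elim!: eventually_mono)
qed

text \<open>
  The modular is countably convex: its integrand is, by Jensen's inequality in each point, and its
  supremum part is countably sublinear.
\<close>

lemma modular_suminf_le:
  fixes f :: "nat \<Rightarrow> real^'n \<Rightarrow> ennreal"
  assumes r: "r \<in> exponents" and [measurable]: "\<And>k. f k \<in> borel_measurable lebesgue"
    and \<theta>: "(\<Sum>k. \<theta> k) = 1"
  shows "modular r (\<lambda>x. \<Sum>k. \<theta> k * f k x) \<le> (\<Sum>k. \<theta> k * modular r (f k))"
proof -
  have rm [measurable]: "r \<in> borel_measurable lebesgue" and r1: "1 \<le> r x" for x
    using r by (auto simp: exponents_def)
  note [measurable] = sets_exponent_eq_infty[OF rm]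
  let ?I = "\<lambda>f. \<integral>\<^sup>+x\<in>{x. r x \<noteq> \<infinity>}. epow (f x) (enn2real (r x)) \<partial>lebesgue"
  let ?S = "\<lambda>f. esssup (restrict_space lebesgue {x. r x = \<infinity>}) f"
  have "?I (\<lambda>x. \<Sum>k. \<theta> k * f k x)
      \<le> (\<integral>\<^sup>+x. (\<Sum>k. \<theta> k * (epow (f k x) (enn2real (r x)) * indicator {x. r x \<noteq> \<infinity>} x)) \<partial>lebesgue)"
  proof (intro nn_integral_mono)
    fix x
    show "epow (\<Sum>k. \<theta> k * f k x) (enn2real (r x)) * indicator {x. r x \<noteq> \<infinity>} x
      \<le> (\<Sum>k. \<theta> k * (epow (f k x) (enn2real (r x)) * indicator {x. r x \<noteq> \<infinity>} x))"
    proof (cases "r x")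
      case (real a)
      then have "1 \<le> a" using r1[of x] by simp
      then show ?thesis using real epow_suminf_le[OF \<theta>, of a "\<lambda>k. f k x"] by simp
    qed simp
  qed
  also have "\<dots> = (\<Sum>k. \<theta> k * ?I (f k))"
    by (simp add: nn_integral_suminf nn_integral_cmult)
  finally have I: "?I (\<lambda>x. \<Sum>k. \<theta> k * f k x) \<le> (\<Sum>k. \<theta> k * ?I (f k))" .
  have "AE x in lebesgue. \<forall>k. r x = \<infinity> \<longrightarrow> f k x \<le> ?S (f k)"
    unfolding AE_all_countable
  proof
    fix k
    show "AE x in lebesgue. r x = \<infinity> \<longrightarrow> f k x \<le> ?S (f k)"
      using esssup_restrict_le_iff[of "f k" lebesgue "{x. r x = \<infinity>}" "?S (f k)"]
        sets_exponent_eq_infty[OF rm] by simp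
  qed
  then have S: "?S (\<lambda>x. \<Sum>k. \<theta> k * f k x) \<le> (\<Sum>k. \<theta> k * ?S (f k))"
    using sets_exponent_eq_infty[OF rm] by (subst esssup_restrict_le_iff)
       (auto elim!: eventually_mono intro!: suminf_le mult_left_mono)
  have "(\<Sum>k. \<theta> k * modular r (f k)) = (\<Sum>k. \<theta> k * ?I (f k)) + (\<Sum>k. \<theta> k * ?S (f k))"
    by (subst suminf_add) (auto simp: modular_def distrib_left)
  then show ?thesis using I S by (simp add: modular_def[of r "\<lambda>x. \<Sum>k. \<theta> k * f k x"] add_mono)
qed

lemma vnorm_eq_Inf_modular:
  assumes r: "r \<in> borel_measurable lebesgue" and f: "f \<in> borel_measurable lebesgue"
  shows "vnorm r f = Inf {ennreal t | t. 0 < t \<and> modular r (\<lambda>x. f x / ennreal t) \<le> 1}"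
proof -
  let ?S = "restrict_space lebesgue {x. r x = \<infinity>}"
  have "esssup ?S (\<lambda>x. f x / ennreal t) = esssup ?S f / ennreal t" if t: "0 < t" for t
  proof (rule antisym)
    have 1: "esssup ?S (\<lambda>x. f x / ennreal t) \<le> c \<longleftrightarrow> esssup ?S f / ennreal t \<le> c" for c
      using f sets_exponent_eq_infty[OF r] by (simp add: esssup_restrict_le_iff ennreal_divide_le_iff[OF t])
    show "esssup ?S (\<lambda>x. f x / ennreal t) \<le> esssup ?S f / ennreal t" by (rule 1[THEN iffD2]) simp
    show "esssup ?S f / ennreal t \<le> esssup ?S (\<lambda>x. f x / ennreal t)" by (rule 1[THEN iffD1]) simp
  qed
  then have "{ennreal t | t. 0 < t \<and> modular r (\<lambda>x. f x / ennreal t) \<le> 1} =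
    {ennreal t | t. 0 < t \<and> (\<integral>\<^sup>+x\<in>{x. r x \<noteq> \<infinity>}. epow (f x / ennreal t) (enn2real (r x)) \<partial>lebesgue)
       + esssup ?S f / ennreal t \<le> 1}"
    unfolding modular_def by (intro Collect_cong ex_cong1) auto
  then show ?thesis by (simp add: vnorm_def)
qed

lemma vnorm_leI:
  assumes "r \<in> borel_measurable lebesgue" "f \<in> borel_measurable lebesgue"
    and "0 < t" "modular r (\<lambda>x. f x / ennreal t) \<le> 1"
  shows "vnorm r f \<le> ennreal t"
  using assms by (auto simp: vnorm_eq_Inf_modular intro!: Inf_lower)

lemma modular_le_1I:
  assumes [measurable]: "r \<in> borel_measurable lebesgue" "f \<in> borel_measurable lebesgue"
    and lt: "vnorm r f < ennreal t"
  shows "modular r (\<lambda>x. f x / ennreal t) \<le> 1"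
proof -
  obtain s where s: "0 < s" "modular r (\<lambda>x. f x / ennreal s) \<le> 1" "ennreal s < ennreal t"
    using lt by (auto simp: vnorm_eq_Inf_modular Inf_less_iff)
  have "modular r (\<lambda>x. f x / ennreal t) \<le> modular r (\<lambda>x. f x / ennreal s)"
  proof (intro modular_AE_mono AE_I2)
    fix x
    have "s < t" using s by (simp add: ennreal_less_iff)
    then have "inverse (ennreal t) \<le> inverse (ennreal s)"
      using s(1) by (simp add: inverse_ennreal le_imp_inverse_le)
    then show "f x / ennreal t \<le> f x / ennreal s"
      unfolding divide_ennreal_def by (intro mult_left_mono) auto
  qed measurable
  with s show ?thesis by auto
qed

lemma vnorm_AE_mono:
  assumes [measurable]: "r \<in> borel_measurable lebesgue" "f \<in> borel_measurable lebesgue" "g \<in> borel_measurable lebesgue"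
    and le: "AE x in lebesgue. f x \<le> g x"
  shows "vnorm r f \<le> vnorm r g"
proof -
  have "modular r (\<lambda>x. f x / ennreal t) \<le> modular r (\<lambda>x. g x / ennreal t)" for t
    using le by (intro modular_AE_mono) (auto elim!: eventually_mono intro: divide_right_mono_ennreal)
  then show ?thesis
    by (auto simp: vnorm_eq_Inf_modular intro!: Inf_superset_mono dest: order_trans)
qed

lemma vnorm_AE_cong:
  assumes "r \<in> borel_measurable lebesgue" "f \<in> borel_measurable lebesgue" "g \<in> borel_measurable lebesgue"
    and eq: "AE x in lebesgue. f x = g x"
  shows "vnorm r f = vnorm r g"
  using eq by (intro antisym vnorm_AE_mono assms) (auto elim!: eventually_mono)

lemma vnorm_finite_imp_AE_finite:
  assumes r [measurable]: "r \<in> borel_measurable lebesgue" and [measurable]: "f \<in> borel_measurable lebesgue"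
    and fin: "vnorm r f < \<infinity>"
  shows "AE x in lebesgue. f x < \<infinity>"
proof -
  note [measurable] = sets_exponent_eq_infty[OF r]
  obtain t where t: "0 < t" "modular r (\<lambda>x. f x / ennreal t) \<le> 1"
    using fin by (auto simp: vnorm_eq_Inf_modular Inf_less_iff)
  have fin_iff: "f x / ennreal t = \<infinity> \<longleftrightarrow> f x = \<infinity>" for x
    using t by (auto simp: ennreal_divide_eq_top_iff)
  have "(\<integral>\<^sup>+x\<in>{x. r x \<noteq> \<infinity>}. epow (f x / ennreal t) (enn2real (r x)) \<partial>lebesgue) \<le> 1"
    using t(2) order_trans[OF _ t(2)] by (auto simp: modular_def)
  then have "AE x in lebesgue. epow (f x / ennreal t) (enn2real (r x)) * indicator {x. r x \<noteq> \<infinity>} x \<noteq> \<infinity>"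
    by (intro nn_integral_PInf_AE) (auto simp: top_unique)
  moreover have "esssup (restrict_space lebesgue {x. r x = \<infinity>}) (\<lambda>x. f x / ennreal t) \<le> 1"
    using order_trans[OF _ t(2)] by (auto simp: modular_def)
  then have "AE x in lebesgue. x \<in> {x. r x = \<infinity>} \<longrightarrow> f x / ennreal t \<le> 1"
    using sets_exponent_eq_infty[OF r] by (subst (asm) esssup_restrict_le_iff) auto
  ultimately show ?thesis
  proof eventually_elim
    case (elim x)
    then show ?case
      using fin_iff[of x] by (cases "r x = \<infinity>") (auto simp: less_top top_unique)
  qed
qed

lemma vnorm_cmult_le:
  assumes [measurable]: "r \<in> borel_measurable lebesgue" "f \<in> borel_measurable lebesgue" and c: "0 < c"
  shows "vnorm r (\<lambda>x. ennreal c * f x) \<le> ennreal c * vnorm r f"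
proof -
  have eq: "ennreal c * f x / ennreal (c * t) = f x / ennreal t" if "0 < t" for x t
    using that c divide_mult_eq[of "ennreal c" "f x" "ennreal t"] by (simp add: ennreal_mult mult.commute)
  have "vnorm r (\<lambda>x. ennreal c * f x) / ennreal c \<le> vnorm r f"
    unfolding vnorm_eq_Inf_modular[OF assms(1,2)]
  proof (intro Inf_greatest, clarsimp)
    fix t :: real assume t: "0 < t" "modular r (\<lambda>x. f x / ennreal t) \<le> 1"
    then have "vnorm r (\<lambda>x. ennreal c * f x) \<le> ennreal (c * t)"
      using c by (intro vnorm_leI) (auto simp: eq)
    then show "vnorm r (\<lambda>x. ennreal c * f x) / ennreal c \<le> ennreal t"
      using c t by (simp add: ennreal_divide_le_iff ennreal_mult mult.commute)
  qed
  then show ?thesis using c by (simp add: ennreal_divide_le_iff mult.commute)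
qed

text \<open>
  For \<open>l\<^sub>k\<close> slightly larger than the norm of \<open>f\<^sub>k\<close> and \<open>L = \<Sum>\<^sub>k l\<^sub>k\<close>, the function \<open>(\<Sum>\<^sub>k f\<^sub>k) / L\<close>
  is the convex combination of the \<open>f\<^sub>k / l\<^sub>k\<close> with weights \<open>l\<^sub>k / L\<close>, and each \<open>f\<^sub>k / l\<^sub>k\<close> has modular
  at most \<open>1\<close>.
\<close>

lemma vnorm_suminf_le:
  fixes f :: "nat \<Rightarrow> real^'n \<Rightarrow> ennreal"
  assumes r: "r \<in> exponents" and f [measurable]: "\<And>k. f k \<in> borel_measurable lebesgue"
  shows "vnorm r (\<lambda>x. \<Sum>k. f k x) \<le> (\<Sum>k. vnorm r (f k))"
proof (cases "(\<Sum>k. vnorm r (f k)) = \<infinity>")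
  case False
  have rm [measurable]: "r \<in> borel_measurable lebesgue"
    using r by (auto simp: exponents_def)
  have fin: "vnorm r (f k) < \<infinity>" for k
    using False ennreal_suminf_lessD[of "\<lambda>k. vnorm r (f k)" \<infinity>] by (auto simp: less_top)
  show ?thesis
  proof (rule ennreal_le_epsilon)
    fix e :: real assume e: "0 < e"
    \<comment> \<open>The excess \<open>e\<close> is distributed over the terms by a geometric series.\<close>
    define l where "l k = enn2real (vnorm r (f k)) + e * (1 / 2) ^ Suc k" for k
    have l: "0 < l k" "vnorm r (f k) < ennreal (l k)" for k
    proof -
      show "0 < l k" using e by (simp add: l_def add_nonneg_pos)
      show "vnorm r (f k) < ennreal (l k)"
        using e fin[of k] by (cases "vnorm r (f k)") (auto simp: l_def ennreal_less_iff)
    qed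
    have sum: "(\<Sum>k. ennreal (l k)) = (\<Sum>k. vnorm r (f k)) + ennreal e"
    proof -
      have "(\<lambda>k. e * (1 / 2) ^ Suc k) sums (e * 1)"
        by (intro sums_mult power_half_series)
      then have "(\<Sum>k. ennreal (e * (1 / 2) ^ Suc k)) = ennreal e"
        using e by (subst suminf_ennreal_eq) auto
      moreover have "ennreal (l k) = vnorm r (f k) + ennreal (e * (1 / 2) ^ Suc k)" for k
        using e fin[of k] by (simp add: l_def)
      ultimately show ?thesis
        using suminf_add[of "\<lambda>k. vnorm r (f k)" "\<lambda>k. ennreal (e * (1 / 2) ^ Suc k)"] by simp
    qed
    define L where "L = enn2real ((\<Sum>k. vnorm r (f k)) + ennreal e)"
    have L: "(\<Sum>k. vnorm r (f k)) + ennreal e = ennreal L"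
      using False by (simp add: L_def less_top)
    have L0: "0 < L"
      using e False by (simp add: L_def enn2real_positive_iff less_top add_pos_pos add_nonneg_pos)
    have "vnorm r (\<lambda>x. \<Sum>k. f k x) \<le> ennreal L"
    proof (rule vnorm_leI[OF rm _ L0])
      let ?\<theta> = "\<lambda>k. ennreal (l k) / ennreal L"
      have \<theta>: "(\<Sum>k. ?\<theta> k) = 1"
        using L0 unfolding ennreal_suminf_divide sum L by (simp add: ennreal_divide_self)
      have "?\<theta> k * (f k x / ennreal (l k)) = f k x / ennreal L" for k x
      proof -
        have "?\<theta> k * (f k x / ennreal (l k)) = (ennreal (l k) / ennreal (l k)) * (f k x / ennreal L)"
          unfolding divide_ennreal_def by (simp only: mult_ac)
        then show ?thesis using l(1)[of k] by (simp add: ennreal_divide_self)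
      qed
      then have "modular r (\<lambda>x. (\<Sum>k. f k x) / ennreal L) = modular r (\<lambda>x. \<Sum>k. ?\<theta> k * (f k x / ennreal (l k)))"
        by simp
      also have "\<dots> \<le> (\<Sum>k. ?\<theta> k * modular r (\<lambda>x. f k x / ennreal (l k)))"
        by (intro modular_suminf_le r \<theta>) measurable
      also have "\<dots> \<le> (\<Sum>k. ?\<theta> k * 1)"
        using l by (intro suminf_le mult_left_mono modular_le_1I) auto
      finally show "modular r (\<lambda>x. (\<Sum>k. f k x) / ennreal L) \<le> 1"
        using \<theta> by simp
    qed auto
    then show "vnorm r (\<lambda>x. \<Sum>k. f k x) \<le> (\<Sum>k. vnorm r (f k)) + ennreal e"
      by (simp add: L)
  qed
qed simp

section \<open>Duality\<close>

lemma ennreal_one_le_inverse: "y \<le> 1 \<Longrightarrow> 1 \<le> inverse y" for y :: ennreal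
  by (cases y) (auto simp: inverse_ennreal le_less one_less_inverse top_unique)

text \<open>
  Truncated subtraction makes the conjugate infinite also where \<open>r < 1\<close>. So the conjugate of an
  exponent that is at least \<open>1\<close> only almost everywhere is at least \<open>1\<close> everywhere.
\<close>

lemma conj_exponent_eq_infty:
  assumes "r x \<le> 1" shows "conj_exponent r x = \<infinity>"
  using ennreal_one_le_inverse[OF assms] by (simp add: conj_exponent_def diff_eq_0_ennreal)

lemma conj_exponent_infty: "r x = \<infinity> \<Longrightarrow> conj_exponent r x = 1"
  by (simp add: conj_exponent_def)

lemma conj_exponent_finite:
  assumes "1 < a" "r x = ennreal a" shows "conj_exponent r x = ennreal (a / (a - 1))"
proof -
  have "1 - inverse (ennreal a) = ennreal (1 - inverse a)"
    using assms by (simp add: inverse_ennreal ennreal_minus flip: ennreal_1)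
  then show ?thesis
    using assms by (simp add: conj_exponent_def inverse_ennreal field_simps)
qed

lemma conj_exponent_in_exponents:
  assumes [measurable]: "r \<in> borel_measurable lebesgue"
  shows "conj_exponent r \<in> exponents"
proof -
  have "1 \<le> conj_exponent r x" for x
    unfolding conj_exponent_def by (intro ennreal_one_le_inverse diff_le_self_ennreal)
  then show ?thesis by (simp add: exponents_def)
qed

text \<open>
  Where one of the exponents is infinite, the other is \<open>1\<close> and the essential supremum bounds one
  factor by \<open>1\<close>; elsewhere Young's inequality applies.
\<close>

lemma modular_Hoelder:
  assumes q [measurable]: "q \<in> borel_measurable lebesgue" and q1: "AE x in lebesgue. 1 \<le> q x"
    and [measurable]: "u \<in> borel_measurable lebesgue" "v \<in> borel_measurable lebesgue"
    and u: "modular q u \<le> 1" and v: "modular (conj_exponent q) v \<le> 1"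
  shows "(\<integral>\<^sup>+x. u x * v x \<partial>lebesgue) \<le> 2"
proof -
  let ?s = "conj_exponent q"
  have s [measurable]: "?s \<in> borel_measurable lebesgue" by measurable
  note sets [measurable] = sets_exponent_eq_infty[OF q] sets_exponent_eq_infty[OF s]
  let ?U = "\<lambda>x. epow (u x) (enn2real (q x)) * indicator {x. q x \<noteq> \<infinity>} x"
  let ?V = "\<lambda>x. epow (v x) (enn2real (?s x)) * indicator {x. ?s x \<noteq> \<infinity>} x"
  have U: "(\<integral>\<^sup>+x. ?U x \<partial>lebesgue) \<le> 1" and V: "(\<integral>\<^sup>+x. ?V x \<partial>lebesgue) \<le> 1"
    using order_trans[OF _ u] order_trans[OF _ v] by (auto simp: modular_def)
  have "esssup (restrict_space lebesgue {x. q x = \<infinity>}) u \<le> 1"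
    using order_trans[OF _ u] by (auto simp: modular_def)
  then have u1: "AE x in lebesgue. x \<in> {x. q x = \<infinity>} \<longrightarrow> u x \<le> 1"
    using sets by (subst (asm) esssup_restrict_le_iff) auto
  have "esssup (restrict_space lebesgue {x. ?s x = \<infinity>}) v \<le> 1"
    using order_trans[OF _ v] by (auto simp: modular_def)
  then have v1: "AE x in lebesgue. x \<in> {x. ?s x = \<infinity>} \<longrightarrow> v x \<le> 1"
    using sets by (subst (asm) esssup_restrict_le_iff) auto
  have "AE x in lebesgue. u x * v x \<le> ?U x + ?V x"
    using u1 v1 q1
  proof eventually_elim
    case (elim x)
    have epow1: "epow y 1 = y" for y by (cases y) (auto simp: epow_def)
    consider "q x = \<infinity>" | "q x = 1" | a where "1 < a" "q x = ennreal a"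
      using elim(3) by (cases "q x") (auto simp: le_less)
    then show ?case
    proof cases
      case 1
      then show ?thesis
        using elim(1) mult_right_mono[of "u x" 1 "v x"] by (simp add: conj_exponent_infty epow1)
    next
      case 2
      then show ?thesis
        using elim(2) mult_left_mono[of "v x" 1 "u x"] by (simp add: conj_exponent_eq_infty epow1)
    next
      case 3
      have "u x * v x \<le> epow (u x) a + epow (v x) (a / (a - 1))"
        by (rule epow_Young) (use 3 in \<open>auto simp: field_simps\<close>)
      then show ?thesis
        using 3 by (simp add: conj_exponent_finite[of a q x])
    qed
  qed
  then have "(\<integral>\<^sup>+x. u x * v x \<partial>lebesgue) \<le> (\<integral>\<^sup>+x. ?U x + ?V x \<partial>lebesgue)"
    by (rule nn_integral_mono_AE)
  also have "\<dots> = (\<integral>\<^sup>+x. ?U x \<partial>lebesgue) + (\<integral>\<^sup>+x. ?V x \<partial>lebesgue)"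
    by (rule nn_integral_add) measurable
  also have "\<dots> \<le> 1 + 1" using U V by (rule add_mono)
  finally show ?thesis by simp
qed

lemma vnorm_Hoelder:
  assumes q [measurable]: "q \<in> borel_measurable lebesgue" and q1: "AE x in lebesgue. 1 \<le> q x"
    and [measurable]: "f \<in> borel_measurable lebesgue" "g \<in> borel_measurable lebesgue"
    and f: "vnorm q f < ennreal s" and g: "vnorm (conj_exponent q) g < ennreal t"
  shows "(\<integral>\<^sup>+x. f x * g x \<partial>lebesgue) \<le> ennreal (2 * s * t)"
proof -
  have st: "0 < s" "0 < t"
    using f g by (metis ennreal_0 ennreal_neg linorder_not_less not_less_zero)+
  have "f x * g x = ennreal (s * t) * (f x / ennreal s * (g x / ennreal t))" for x
  proof -
    have "ennreal (s * t) * (f x / ennreal s * (g x / ennreal t))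
        = (ennreal s / ennreal s) * (ennreal t / ennreal t) * (f x * g x)"
      using st by (simp only: divide_ennreal_def mult_ac ennreal_mult less_imp_le)
    then show ?thesis using st by (simp add: ennreal_divide_self)
  qed
  then have "(\<integral>\<^sup>+x. f x * g x \<partial>lebesgue)
      = ennreal (s * t) * (\<integral>\<^sup>+x. f x / ennreal s * (g x / ennreal t) \<partial>lebesgue)"
    by (simp add: nn_integral_cmult)
  also have "\<dots> \<le> ennreal (s * t) * 2"
    using f g by (intro mult_left_mono modular_Hoelder[OF q q1] modular_le_1I) auto
  also have "\<dots> = ennreal (2 * s * t)"
    using st by (simp add: ennreal_mult mult_ac)
  finally show ?thesis .
qed

text \<open>
  The integrals over the sets where \<open>h \<le> n\<close> and \<open>|x| \<le> n\<close> are finite, and they increase to the whole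
  integral.
\<close>

lemma exists_set_finite_integral_gt:
  fixes h :: "real^'n \<Rightarrow> ennreal"
  assumes [measurable]: "h \<in> borel_measurable lebesgue" and fin: "AE x in lebesgue. h x < \<infinity>"
    and gt: "c < (\<integral>\<^sup>+x. h x \<partial>lebesgue)"
  obtains E where "E \<in> sets lebesgue" "c < (\<integral>\<^sup>+x\<in>E. h x \<partial>lebesgue)" "(\<integral>\<^sup>+x\<in>E. h x \<partial>lebesgue) < \<infinity>"
proof -
  define E where "E n = {x \<in> space lebesgue. h x \<le> of_nat n} \<inter> cball 0 (real n)" for n
  have E [measurable]: "E n \<in> sets lebesgue" for n
  proof -
    have "{x \<in> space lebesgue. h x \<le> of_nat n} \<in> sets lebesgue" by measurable
    then show ?thesis unfolding E_def by (intro sets.Int) auto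
  qed
  have mono: "E m \<subseteq> E n" if "m \<le> n" for m n
    using that by (auto simp: E_def intro: order_trans[OF _ of_nat_mono])
  have "(SUP n. h x * indicator (E n) x) = h x" if "h x < \<infinity>" for x
  proof (rule antisym)
    obtain m :: nat where m: "h x < of_nat m" using \<open>h x < \<infinity>\<close> ennreal_Ex_less_of_nat by auto
    obtain k :: nat where k: "norm x \<le> real k" using real_arch_simple by blast
    have "x \<in> E (max m k)"
      using m k by (auto simp: E_def intro: order_trans[OF less_imp_le])
    then show "h x \<le> (SUP n. h x * indicator (E n) x)"
      by (intro SUP_upper2[of "max m k"]) auto
  qed (auto intro!: SUP_least simp: indicator_def)
  with fin have "(\<integral>\<^sup>+x. h x \<partial>lebesgue) = (\<integral>\<^sup>+x. (SUP n. h x * indicator (E n) x) \<partial>lebesgue)"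
    by (intro nn_integral_cong_AE) (auto elim!: eventually_mono)
  also have "\<dots> = (SUP n. \<integral>\<^sup>+x\<in>E n. h x \<partial>lebesgue)"
    using mono by (intro nn_integral_monotone_convergence_SUP)
      (auto simp: incseq_def le_fun_def intro!: mult_left_mono split: split_indicator)
  finally obtain n where n: "c < (\<integral>\<^sup>+x\<in>E n. h x \<partial>lebesgue)"
    using gt by (auto simp: less_SUP_iff)
  have "(\<integral>\<^sup>+x\<in>E n. h x \<partial>lebesgue) \<le> (\<integral>\<^sup>+x. of_nat n * indicator (cball 0 (real n) :: (real^'n) set) x \<partial>lebesgue)"
    by (intro nn_integral_mono) (auto simp: E_def split: split_indicator)
  also have "\<dots> = of_nat n * emeasure lebesgue (cball 0 (real n) :: (real^'n) set)"
    by (rule nn_integral_cmult_indicator) auto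
  also have "\<dots> < \<infinity>"
    using emeasure_bounded_finite[of "cball 0 (real n) :: (real^'n) set"]
    by (auto simp: ennreal_mult_less_top of_nat_less_top)
  finally show ?thesis using that[of "E n"] n by simp
qed

text \<open>
  The extremal function is \<open>u\<^sup>q\<^sup>-\<^sup>1\<close>. As the modular of \<open>u\<close> may be infinite, it is restricted to a set
  \<open>E\<close> on which \<open>u\<^sup>q\<close> has a finite integral \<open>A > 1\<close>, and it is divided by \<open>B = 2 A\<close>. The integral
  against \<open>u\<close> is then \<open>A/B = 1/2\<close>. In the modular, the conjugate exponent \<open>q'\<close> turns \<open>u\<^sup>q\<^sup>-\<^sup>1\<close> back into
  \<open>u\<^sup>q\<close>, and since \<open>q' \<ge> 1\<close> and \<open>B \<ge> 1\<close>, the factor \<open>B\<close> to the power \<open>-q'\<close> is at most \<open>1/B\<close>. So the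
  integral part is at most \<open>A/B = 1/2\<close>. On \<open>q = 1\<close>, where \<open>q' = \<infinity>\<close>, the function is at most
  \<open>1/B \<le> 1/2\<close>.
\<close>

lemma modular_dual_function:
  assumes q [measurable]: "q \<in> borel_measurable lebesgue"
    and q1: "AE x in lebesgue. 1 \<le> q x" and qfin: "\<And>x. q x < \<infinity>"
    and [measurable]: "u \<in> borel_measurable lebesgue" and ufin: "AE x in lebesgue. u x < \<infinity>"
    and gt: "1 < modular q u"
  obtains v where "v \<in> borel_measurable lebesgue" "modular (conj_exponent q) v \<le> 1"
    "1 \<le> 2 * (\<integral>\<^sup>+x. u x * v x \<partial>lebesgue)"
proof -
  let ?s = "conj_exponent q"
  let ?h = "\<lambda>x. epow (u x) (enn2real (q x))"
  have s [measurable]: "?s \<in> borel_measurable lebesgue" by measurable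
  note sets [measurable] = sets_exponent_eq_infty[OF s]
  have "AE x in lebesgue. ?h x < \<infinity>"
    using ufin by eventually_elim (metis epow_eq_infty_iff infinity_ennreal_def less_top)
  moreover have "1 < (\<integral>\<^sup>+x. ?h x \<partial>lebesgue)"
    using gt qfin by (simp add: modular_finite_exponent)
  ultimately obtain E where E [measurable]: "E \<in> sets lebesgue"
    and E1: "1 < (\<integral>\<^sup>+x\<in>E. ?h x \<partial>lebesgue)" "(\<integral>\<^sup>+x\<in>E. ?h x \<partial>lebesgue) < \<infinity>"
    by (rule exists_set_finite_integral_gt[rotated 1]) measurable
  define A where "A = enn2real (\<integral>\<^sup>+x\<in>E. ?h x \<partial>lebesgue)"
  have A: "ennreal A = (\<integral>\<^sup>+x\<in>E. ?h x \<partial>lebesgue)"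
    using E1 by (simp add: A_def)
  then have A1: "1 < A" using E1 by (metis ennreal_1 ennreal_less_iff zero_le_one)
  define B where "B = 2 * A"
  define v where "v x = ennreal (1 / B) * (epow (u x) (enn2real (q x) - 1) * indicator E x)" for x
  have [measurable]: "v \<in> borel_measurable lebesgue"
    unfolding v_def by measurable
  have AB: "ennreal (1 / B) * ennreal A = ennreal (1 / 2)"
    using A1 by (simp add: B_def ennreal_mult[symmetric])
  have "(\<integral>\<^sup>+x\<in>{x. ?s x \<noteq> \<infinity>}. epow (v x) (enn2real (?s x)) \<partial>lebesgue)
      \<le> (\<integral>\<^sup>+x. ennreal (1 / B) * (?h x * indicator E x) \<partial>lebesgue)"
  proof (intro nn_integral_mono_AE, use q1 ufin in eventually_elim)
    fix x assume x: "1 \<le> q x" "u x < \<infinity>"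
    show "epow (v x) (enn2real (?s x)) * indicator {x. ?s x \<noteq> \<infinity>} x \<le> ennreal (1 / B) * (?h x * indicator E x)"
    proof (cases "q x = 1 \<or> x \<notin> E")
      case True
      then show ?thesis by (auto simp: conj_exponent_eq_infty v_def)
    next
      case False
      then obtain a where a: "1 < a" "q x = ennreal a"
        using x qfin[of x] by (cases "q x") (auto simp: le_less)
      obtain b where b: "0 \<le> b" "u x = ennreal b" using x by (cases "u x") auto
      have s: "?s x = ennreal (a / (a - 1))" "1 \<le> a / (a - 1)" "0 < a - 1"
        using a conj_exponent_finite[of a q x] by auto
      have "v x = ennreal (1 / B * b powr (a - 1))"
        using a b False A1 by (simp add: v_def epow_ennreal ennreal_mult[symmetric] B_def)
      then have "epow (v x) (enn2real (?s x)) = ennreal ((1 / B * b powr (a - 1)) powr (a / (a - 1)))"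
        using A1 a s by (simp add: epow_ennreal B_def)
      also have "(1 / B * b powr (a - 1)) powr (a / (a - 1)) = (1 / B) powr (a / (a - 1)) * b powr a"
        using A1 a by (subst powr_mult) (auto simp: powr_powr B_def)
      also have "(1 / B) powr (a / (a - 1)) \<le> (1 / B) powr 1"
        using A1 s by (intro powr_mono') (auto simp: B_def)
      finally show ?thesis
        using a b False A1
        by (auto simp: epow_ennreal ennreal_mult[symmetric] B_def mult_right_mono ennreal_leI split: split_indicator)
    qed
  qed
  also have "\<dots> = ennreal (1 / 2)"
    using AB by (simp add: nn_integral_cmult A)
  finally have I: "(\<integral>\<^sup>+x\<in>{x. ?s x \<noteq> \<infinity>}. epow (v x) (enn2real (?s x)) \<partial>lebesgue) \<le> ennreal (1 / 2)" .
  have S: "esssup (restrict_space lebesgue {x. ?s x = \<infinity>}) v \<le> ennreal (1 / 2)"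
  proof (subst esssup_restrict_le_iff)
    show "AE x in lebesgue. x \<in> {x. ?s x = \<infinity>} \<longrightarrow> v x \<le> ennreal (1 / 2)"
      using q1 ufin
    proof eventually_elim
      case (elim x)
      show ?case
      proof
        assume "x \<in> {x. ?s x = \<infinity>}"
        then have "q x = 1"
          using elim qfin[of x] conj_exponent_finite[of _ q x] by (cases "q x") (auto simp: le_less)
        moreover obtain b where "0 \<le> b" "u x = ennreal b" using elim by (cases "u x") auto
        ultimately have "v x \<le> ennreal (1 / B) * 1"
          unfolding v_def by (intro mult_left_mono) (auto simp: epow_ennreal split: split_indicator)
        also have "\<dots> \<le> ennreal (1 / 2)"
          unfolding mult_1_right using A1 by (intro ennreal_leI) (simp add: B_def field_simps)
        finally show "v x \<le> ennreal (1 / 2)" .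
      qed
    qed
  qed (use sets in auto)
  have "modular ?s v \<le> ennreal (1 / 2) + ennreal (1 / 2)"
    unfolding modular_def using I S by (rule add_mono)
  then have "modular ?s v \<le> 1"
    by (simp add: ennreal_plus[symmetric] del: ennreal_plus ennreal_half)
  moreover have "(\<integral>\<^sup>+x. u x * v x \<partial>lebesgue) = (\<integral>\<^sup>+x. ennreal (1 / B) * (?h x * indicator E x) \<partial>lebesgue)"
  proof (intro nn_integral_cong_AE, use ufin in eventually_elim)
    fix x assume "u x < \<infinity>"
    then obtain b where b: "0 \<le> b" "u x = ennreal b" by (cases "u x") auto
    have "b * b powr (a - 1) = b powr a" for a
      using b by (cases "b = 0") (auto simp: powr_diff)
    then have "u x * epow (u x) (enn2real (q x) - 1) = ?h x"
      using b by (simp add: epow_ennreal ennreal_mult[symmetric])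
    then show "u x * v x = ennreal (1 / B) * (?h x * indicator E x)"
      unfolding v_def by (metis mult.assoc mult.left_commute)
  qed
  then have "(\<integral>\<^sup>+x. u x * v x \<partial>lebesgue) = ennreal (1 / 2)"
    using AB by (simp add: nn_integral_cmult A)
  then have "1 \<le> 2 * (\<integral>\<^sup>+x. u x * v x \<partial>lebesgue)"
    by (simp add: ennreal_mult[symmetric] flip: ennreal_numeral del: ennreal_half)
  ultimately show ?thesis using that[of v] by simp
qed

text \<open>
  The norm of \<open>f\<close> is tested against a function in the unit ball of the dual space, at any level
  below the norm.
\<close>

lemma vnorm_dual_function:
  assumes q [measurable]: "q \<in> borel_measurable lebesgue"
    and q1: "AE x in lebesgue. 1 \<le> q x" and qfin: "\<And>x. q x < \<infinity>"
    and f [measurable]: "f \<in> borel_measurable lebesgue" and fin: "vnorm q f < \<infinity>"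
    and t: "0 < t" "ennreal t < vnorm q f"
  obtains v where "v \<in> borel_measurable lebesgue" "vnorm (conj_exponent q) v \<le> 1"
    "ennreal t \<le> 2 * (\<integral>\<^sup>+x. f x * v x \<partial>lebesgue)"
proof -
  have "AE x in lebesgue. f x < \<infinity>"
    using q f fin by (rule vnorm_finite_imp_AE_finite)
  then have "AE x in lebesgue. f x / ennreal t < \<infinity>"
    using t(1) by (auto elim!: eventually_mono simp: ennreal_divide_eq_top_iff order.strict_iff_not top_unique)
  moreover have "1 < modular q (\<lambda>x. f x / ennreal t)"
    using vnorm_leI[OF q f t(1)] t(2) by (meson not_le)
  ultimately obtain v where v [measurable]: "v \<in> borel_measurable lebesgue"
    and "modular (conj_exponent q) v \<le> 1" and ge: "1 \<le> 2 * (\<integral>\<^sup>+x. f x / ennreal t * v x \<partial>lebesgue)"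
    using modular_dual_function[OF q q1 qfin, of "\<lambda>x. f x / ennreal t"] by auto
  then have "vnorm (conj_exponent q) v \<le> ennreal 1"
    by (intro vnorm_leI) (auto simp: divide_ennreal_def)
  moreover have "ennreal t \<le> 2 * (\<integral>\<^sup>+x. f x * v x \<partial>lebesgue)"
  proof -
    have "ennreal t * 1 \<le> ennreal t * (2 * (\<integral>\<^sup>+x. f x / ennreal t * v x \<partial>lebesgue))"
      using ge by (rule mult_left_mono) simp
    also have "\<dots> = 2 * (\<integral>\<^sup>+x. ennreal t * (f x / ennreal t * v x) \<partial>lebesgue)"
      by (simp add: nn_integral_cmult mult_ac)
    also have "(\<lambda>x. ennreal t * (f x / ennreal t * v x)) = (\<lambda>x. f x * v x)"
    proof
      fix x
      have "ennreal t * (f x / ennreal t * v x) = (ennreal t / ennreal t) * (f x * v x)"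
        unfolding divide_ennreal_def by (simp only: mult_ac)
      then show "ennreal t * (f x / ennreal t * v x) = f x * v x"
        using t(1) by (simp add: ennreal_divide_self)
    qed
    finally show ?thesis by simp
  qed
  ultimately show ?thesis using that[of v] by simp
qed

section \<open>The maximal operator and the Rubio de Francia algorithm\<close>

text \<open>
  The maximal operator on \<open>[0,\<infinity>]\<close>-valued functions. It can be iterated and applied to infinite
  series, which \<open>maximal\<close> cannot, since its values may be infinite while its arguments are real.
\<close>

definition ball_maximal :: "(real^'n \<Rightarrow> ennreal) \<Rightarrow> real^'n \<Rightarrow> ennreal" where
  "ball_maximal f x = (SUP B\<in>{B \<in> balls. x \<in> B}. (\<integral>\<^sup>+y\<in>B. f y \<partial>lebesgue) / emeasure lebesgue B)"

lemma maximal_eq_ball_maximal: "maximal f = ball_maximal (\<lambda>x. ennreal \<bar>f x\<bar>)"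
  by (simp add: fun_eq_iff maximal_def ball_maximal_def)

lemma average_le_ball_maximal:
  "B \<in> balls \<Longrightarrow> x \<in> B \<Longrightarrow> (\<integral>\<^sup>+y\<in>B. f y \<partial>lebesgue) / emeasure lebesgue B \<le> ball_maximal f x"
  unfolding ball_maximal_def by (rule SUP_upper) simp

lemma sets_balls: "B \<in> balls \<Longrightarrow> B \<in> sets lebesgue"
  by (auto simp: balls_def)

text \<open>
  The superlevel sets are unions of balls, hence open.
\<close>

lemma borel_measurable_ball_maximal [measurable]: "ball_maximal f \<in> borel_measurable lebesgue"
proof (rule borel_measurableI_greater)
  fix a
  have "{x \<in> space lebesgue. a < ball_maximal f x}
      = \<Union>{B \<in> balls. a < (\<integral>\<^sup>+y\<in>B. f y \<partial>lebesgue) / emeasure lebesgue B}"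
    by (auto simp: ball_maximal_def less_SUP_iff)
  moreover have "open \<dots>"
    by (auto simp: balls_def intro!: open_Union)
  ultimately show "{x \<in> space lebesgue. a < ball_maximal f x} \<in> sets lebesgue"
    by simp
qed

lemma ball_maximal_AE_cong:
  assumes "AE x in lebesgue. f x = g x" shows "ball_maximal f = ball_maximal g"
proof -
  have "(\<integral>\<^sup>+y\<in>B. f y \<partial>lebesgue) = (\<integral>\<^sup>+y\<in>B. g y \<partial>lebesgue)" for B
    using assms by (intro nn_integral_cong_AE) (auto elim!: eventually_mono)
  then show ?thesis by (simp add: fun_eq_iff ball_maximal_def)
qed

lemma ball_maximal_cmult_suminf_le:
  fixes f :: "nat \<Rightarrow> real^'n \<Rightarrow> ennreal"
  assumes [measurable]: "\<And>k. f k \<in> borel_measurable lebesgue"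
  shows "ball_maximal (\<lambda>x. \<Sum>k. a k * f k x) x \<le> (\<Sum>k. a k * ball_maximal (f k) x)"
  unfolding ball_maximal_def[of "\<lambda>x. \<Sum>k. a k * f k x"]
proof (intro SUP_least)
  fix B assume "B \<in> {B \<in> balls. x \<in> B}"
  then have B: "B \<in> balls" "x \<in> B" and [measurable]: "B \<in> sets lebesgue" by (auto simp: sets_balls)
  have "(\<integral>\<^sup>+y\<in>B. (\<Sum>k. a k * f k y) \<partial>lebesgue) = (\<Sum>k. a k * (\<integral>\<^sup>+y\<in>B. f k y \<partial>lebesgue))"
    by (simp add: nn_integral_suminf nn_integral_cmult mult.assoc flip: ennreal_suminf_multc)
  then have "(\<integral>\<^sup>+y\<in>B. (\<Sum>k. a k * f k y) \<partial>lebesgue) / emeasure lebesgue B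
      = (\<Sum>k. a k * ((\<integral>\<^sup>+y\<in>B. f k y \<partial>lebesgue) / emeasure lebesgue B))"
    by (simp add: ennreal_times_divide)
  also have "\<dots> \<le> (\<Sum>k. a k * ball_maximal (f k) x)"
    using B by (intro suminf_le mult_left_mono average_le_ball_maximal) auto
  finally show "(\<integral>\<^sup>+y\<in>B. (\<Sum>k. a k * f k y) \<partial>lebesgue) / emeasure lebesgue B
      \<le> (\<Sum>k. a k * ball_maximal (f k) x)" .
qed

text \<open>
  The average of \<open>w\<close> over a ball is at most \<open>M w \<le> K w\<close> at each point of the ball, hence at most \<open>K\<close> times the
  essential infimum over it.
\<close>

lemma A1_weightsI:
  assumes [measurable]: "w \<in> borel_measurable lebesgue"
    and le: "\<And>x. ball_maximal w x \<le> ennreal K * w x" and K: "0 < K"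
  shows "w \<in> A1_weights"
proof -
  have "((\<integral>\<^sup>+x\<in>B. w x \<partial>lebesgue) / emeasure lebesgue B) / essinf (restrict_space lebesgue B) w \<le> ennreal K"
    if B: "B \<in> balls" for B
  proof -
    let ?a = "(\<integral>\<^sup>+x\<in>B. w x \<partial>lebesgue) / emeasure lebesgue B"
    have "?a / ennreal K \<le> w x" if "x \<in> B" for x
    proof -
      have "?a \<le> ball_maximal w x"
        using B that by (rule average_le_ball_maximal)
      also note le
      finally show ?thesis using K by (simp add: ennreal_divide_le_iff mult.commute)
    qed
    then have "?a / ennreal K \<le> essinf (restrict_space lebesgue B) w"
      unfolding essinf_eq_AE using B
      by (intro Sup_upper) (auto simp: AE_restrict_space_iff sets_balls)
    then have a: "?a \<le> ennreal K * essinf (restrict_space lebesgue B) w"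
      using K by (simp add: ennreal_divide_le_iff mult.commute)
    show ?thesis
    proof (cases "essinf (restrict_space lebesgue B) w")
      case (real e)
      \<comment> \<open>If the infimum vanishes, so does the average, and \<open>0/0 = 0\<close>.\<close>
      show ?thesis
      proof (cases "e = 0")
        case False
        then show ?thesis using a real by (simp add: ennreal_divide_le_iff)
      qed (use a real in simp)
    qed simp
  qed
  then have "(SUP B\<in>balls. ((\<integral>\<^sup>+x\<in>B. w x \<partial>lebesgue) / emeasure lebesgue B)
      / essinf (restrict_space lebesgue B) w) \<le> ennreal K"
    by (rule SUP_least)
  then show ?thesis
    by (auto simp: A1_weights_def intro: le_less_trans)
qed

text \<open>
  The bound for real functions extends to \<open>[0,\<infinity>]\<close>-valued ones: if the norm of \<open>f\<close> is finite and the
  weight is positive, \<open>f\<close> is finite almost everywhere, and the averages ignore null sets.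
\<close>

lemma maximal_bounded_onE:
  assumes b: "maximal_bounded_on r v"
    and r [measurable]: "r \<in> borel_measurable lebesgue" and [measurable]: "v \<in> borel_measurable lebesgue"
    and v: "AE x in lebesgue. 0 < v x"
  obtains C where "0 < C" "\<And>f. f \<in> borel_measurable lebesgue \<Longrightarrow> wnorm r v f < \<infinity> \<Longrightarrow>
    wnorm r v (ball_maximal f) \<le> ennreal C * wnorm r v f"
proof -
  obtain C where C: "0 < C" "\<And>f. f \<in> Lp_space r v \<Longrightarrow>
      wnorm r v (maximal f) \<le> ennreal C * wnorm r v (\<lambda>x. ennreal \<bar>f x\<bar>)"
    using b by (auto simp: maximal_bounded_on_def)
  have "wnorm r v (ball_maximal f) \<le> ennreal C * wnorm r v f"
    if [measurable]: "f \<in> borel_measurable lebesgue" and fin: "wnorm r v f < \<infinity>" for f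
  proof -
    let ?g = "\<lambda>x. ennreal \<bar>enn2real (f x)\<bar>"
    have "AE x in lebesgue. f x * v x < \<infinity>"
      using fin by (intro vnorm_finite_imp_AE_finite[OF r]) (auto simp: wnorm_def)
    with v have eq: "AE x in lebesgue. f x = ?g x"
      by eventually_elim (auto simp: ennreal_mult_less_top)
    then have "wnorm r v f = wnorm r v ?g"
      unfolding wnorm_def by (intro vnorm_AE_cong) (auto elim!: eventually_mono)
    moreover from this have "wnorm r v (maximal (\<lambda>x. enn2real (f x))) \<le> ennreal C * wnorm r v ?g"
      using fin by (intro C) (auto simp: Lp_space_def)
    ultimately show ?thesis
      using ball_maximal_AE_cong[OF eq] by (simp add: maximal_eq_ball_maximal)
  qed
  with C(1) show ?thesis by (rule that)
qed

text \<open>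
  \<open>H = \<Sum>\<^sub>k M\<^sup>k h / (2C)\<^sup>k\<close>, where \<open>C\<close> bounds the norm of \<open>M\<close>: applying \<open>M\<close> shifts the series, so
  \<open>M H \<le> 2C H\<close>, and the norms of the terms are dominated by \<open>2\<^sup>-\<^sup>k \<parallel>h\<parallel>\<close>.
\<close>

lemma Rubio_de_Francia_majorant:
  assumes r: "r \<in> exponents" and [measurable]: "v \<in> borel_measurable lebesgue"
    and C: "0 < C" and bound: "\<And>f. f \<in> borel_measurable lebesgue \<Longrightarrow> wnorm r v f < \<infinity> \<Longrightarrow>
      wnorm r v (ball_maximal f) \<le> ennreal C * wnorm r v f"
    and h [measurable]: "h \<in> borel_measurable lebesgue" and fin: "wnorm r v h < \<infinity>"
  obtains H where "H \<in> A1_weights" "\<And>x. h x \<le> H x" "wnorm r v H \<le> 2 * wnorm r v h"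
proof -
  have [measurable]: "r \<in> borel_measurable lebesgue"
    using r by (simp add: exponents_def)
  define h_iter where "h_iter k = (ball_maximal ^^ k) h" for k
  have it0: "h_iter 0 = h" and itS: "\<And>k. ball_maximal (h_iter k) = h_iter (Suc k)"
    by (simp_all add: h_iter_def)
  have it [measurable]: "h_iter k \<in> borel_measurable lebesgue" for k
    by (cases k) (auto simp: it0 itS[symmetric])
  have norm_it: "wnorm r v (h_iter k) \<le> ennreal (C ^ k) * wnorm r v h" for k
  proof (induction k)
    case (Suc k)
    then have "wnorm r v (h_iter k) < \<infinity>"
      using fin by (auto simp: ennreal_mult_less_top intro: le_less_trans)
    then have "wnorm r v (h_iter (Suc k)) \<le> ennreal C * wnorm r v (h_iter k)"
      unfolding itS[symmetric] by (intro bound) auto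
    also have "\<dots> \<le> ennreal C * (ennreal (C ^ k) * wnorm r v h)"
      using Suc by (intro mult_left_mono) auto
    finally show ?case
      using C by (simp add: ennreal_mult mult.assoc)
  qed (simp add: it0)
  define a where "a = 1 / (2 * C)"
  have a: "0 < a" using C by (simp add: a_def)
  define H where "H x = (\<Sum>k. ennreal (a ^ k) * h_iter k x)" for x
  have [measurable]: "H \<in> borel_measurable lebesgue"
    unfolding H_def by measurable
  have "ball_maximal H x \<le> ennreal (2 * C) * H x" for x
  proof -
    have "ball_maximal H x \<le> (\<Sum>k. ennreal (a ^ k) * h_iter (Suc k) x)"
      unfolding H_def itS[symmetric] by (intro ball_maximal_cmult_suminf_le) auto
    also have "\<dots> = (\<Sum>k. ennreal (2 * C) * (ennreal (a ^ Suc k) * h_iter (Suc k) x))"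
    proof (rule suminf_cong)
      fix k
      have "ennreal (a ^ k) = ennreal (2 * C) * ennreal (a ^ Suc k)"
        using C by (subst ennreal_mult[symmetric]) (auto simp: a_def)
      then show "ennreal (a ^ k) * h_iter (Suc k) x = ennreal (2 * C) * (ennreal (a ^ Suc k) * h_iter (Suc k) x)"
        by (simp add: mult.assoc)
    qed
    also have "\<dots> = ennreal (2 * C) * (\<Sum>k. ennreal (a ^ Suc k) * h_iter (Suc k) x)"
      by (rule ennreal_suminf_cmult)
    also have "(\<Sum>k. ennreal (a ^ Suc k) * h_iter (Suc k) x) \<le> H x"
      unfolding H_def by (subst (2) suminf_offset[of _ 1]) auto
    finally show ?thesis by (simp add: mult_left_mono)
  qed
  then have "H \<in> A1_weights"
    using C by (intro A1_weightsI[of H "2 * C"]) auto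
  moreover have "h x \<le> H x" for x
    using sum_le_suminf[of "\<lambda>k. ennreal (a ^ k) * h_iter k x" "{0}"] by (simp add: H_def it0)
  moreover have "wnorm r v H \<le> 2 * wnorm r v h"
  proof -
    have "wnorm r v H = vnorm r (\<lambda>x. \<Sum>k. ennreal (a ^ k) * (h_iter k x * v x))"
      by (simp add: wnorm_def H_def mult.assoc flip: ennreal_suminf_multc)
    also have "\<dots> \<le> (\<Sum>k. vnorm r (\<lambda>x. ennreal (a ^ k) * (h_iter k x * v x)))"
      by (intro vnorm_suminf_le r) measurable
    also have "\<dots> \<le> (\<Sum>k. ennreal ((1 / 2) ^ k) * wnorm r v h)"
    proof (intro suminf_le)
      fix k
      have "vnorm r (\<lambda>x. ennreal (a ^ k) * (h_iter k x * v x)) \<le> ennreal (a ^ k) * wnorm r v (h_iter k)"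
        unfolding wnorm_def using a by (intro vnorm_cmult_le) auto
      also have "\<dots> \<le> ennreal (a ^ k) * (ennreal (C ^ k) * wnorm r v h)"
        by (intro mult_left_mono norm_it) auto
      also have "\<dots> = ennreal (a ^ k * C ^ k) * wnorm r v h"
        using a C by (simp add: ennreal_mult mult.assoc)
      also have "a ^ k * C ^ k = (1 / 2) ^ k"
        using C by (simp add: a_def power_mult_distrib[symmetric])
      finally show "vnorm r (\<lambda>x. ennreal (a ^ k) * (h_iter k x * v x)) \<le> ennreal ((1 / 2) ^ k) * wnorm r v h" .
    qed auto
    also have "\<dots> = (\<Sum>k. ennreal ((1 / 2) ^ k)) * wnorm r v h"
      by (rule ennreal_suminf_multc)
    also have "(\<Sum>k. ennreal ((1 / 2) ^ k)) = ennreal 2"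
      using geometric_sums[of "1 / 2 :: real"] by (intro suminf_ennreal_eq) auto
    finally show ?thesis by simp
  qed
  ultimately show ?thesis by (rule that)
qed

section \<open>Extrapolation\<close>

text \<open>
  Hoelder's inequality for \<open>f w\<close> and \<open>h / w\<close>. It makes the space with exponent \<open>q'\<close> and weight \<open>1/w\<close>
  the natural home of the \<open>A\<^sub>1\<close> weights to test against.
\<close>

lemma nn_integral_mult_weight_le:
  assumes q: "q \<in> borel_measurable lebesgue" "AE x in lebesgue. 1 \<le> q x"
    and [measurable]: "w \<in> borel_measurable lebesgue" and w: "AE x in lebesgue. 0 < w x \<and> w x < \<infinity>"
    and [measurable]: "f \<in> borel_measurable lebesgue" "h \<in> borel_measurable lebesgue"
    and "wnorm q w f < ennreal s" "wnorm (conj_exponent q) (\<lambda>x. inverse (w x)) h < ennreal t"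
  shows "(\<integral>\<^sup>+x. f x * h x \<partial>lebesgue) \<le> ennreal (2 * s * t)"
proof -
  have "(\<integral>\<^sup>+x. f x * h x \<partial>lebesgue) = (\<integral>\<^sup>+x. (f x * w x) * (h x * inverse (w x)) \<partial>lebesgue)"
  proof (intro nn_integral_cong_AE, use w in eventually_elim)
    fix x assume "0 < w x \<and> w x < \<infinity>"
    then have "w x * inverse (w x) = 1"
      by (intro ennreal_mult_inverse_self) auto
    then show "f x * h x = (f x * w x) * (h x * inverse (w x))"
      by (metis mult.assoc mult.left_commute mult.right_neutral)
  qed
  also have "\<dots> \<le> ennreal (2 * s * t)"
    by (intro vnorm_Hoelder[OF q]) (use assms in \<open>auto simp: wnorm_def\<close>)
  finally show ?thesis .
qed

text \<open>
  The constant of the hypothesis may depend on the \<open>A\<^sub>1\<close> weight in an arbitrary way, so the weights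
  for the different pairs have to be combined into one. If no constant works, there are pairs
  \<open>(f\<^sub>k, g\<^sub>k)\<close> and levels \<open>t\<^sub>k\<close> with \<open>4\<^sup>k \<parallel>g\<^sub>k\<parallel> < t\<^sub>k < \<parallel>f\<^sub>k\<parallel>\<close>. Duality provides \<open>u\<^sub>k\<close> in the unit ball for
  \<open>q'\<close> with \<open>t\<^sub>k \<le> 2 \<integral> f\<^sub>k w u\<^sub>k\<close>. The sum \<open>h = \<Sum>\<^sub>k 2\<^sup>-\<^sup>k w u\<^sub>k\<close> has a finite norm with weight \<open>1/w\<close>, hence a
  majorant \<open>H \<in> A\<^sub>1\<close> of finite norm. With the one constant \<open>C\<close> that belongs to \<open>H\<close>, for all \<open>k\<close>,
  up to numerical factors and the norm of \<open>H\<close>,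
  \<open>2\<^sup>-\<^sup>k t\<^sub>k \<le> \<integral> f\<^sub>k H \<le> C \<integral> g\<^sub>k H \<le> C 4\<^sup>-\<^sup>k t\<^sub>k\<close>,
  which bounds \<open>2\<^sup>k\<close>.
\<close>

lemma extrapolation_from_A1:
  fixes F :: "((real^'n \<Rightarrow> ennreal) \<times> (real^'n \<Rightarrow> ennreal)) set"
  assumes meas: "\<And>f g. (f, g) \<in> F \<Longrightarrow> f \<in> borel_measurable lebesgue \<and> g \<in> borel_measurable lebesgue"
    and A1: "\<And>H. H \<in> A1_weights \<Longrightarrow>
      \<exists>C>0. \<forall>(f, g)\<in>F. (\<integral>\<^sup>+x. f x * H x \<partial>lebesgue) < \<infinity> \<longrightarrow>
        (\<integral>\<^sup>+x. f x * H x \<partial>lebesgue) \<le> ennreal C * (\<integral>\<^sup>+x. g x * H x \<partial>lebesgue)"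
    and q [measurable]: "q \<in> borel_measurable lebesgue"
    and q1: "AE x in lebesgue. 1 \<le> q x" and qfin: "\<And>x. q x < \<infinity>"
    and [measurable]: "w \<in> borel_measurable lebesgue" and w: "AE x in lebesgue. 0 < w x \<and> w x < \<infinity>"
    and bounded: "maximal_bounded_on (conj_exponent q) (\<lambda>x. inverse (w x))"
  shows "\<exists>C>0. \<forall>(f, g)\<in>F. wnorm q w f < \<infinity> \<longrightarrow> wnorm q w f \<le> ennreal C * wnorm q w g"
proof (rule ccontr)
  let ?s = "conj_exponent q" and ?v = "\<lambda>x. inverse (w x)"
  have s [measurable]: "?s \<in> borel_measurable lebesgue" by measurable
  assume no_const: "\<not> ?thesis"
  have "\<exists>f g t. (f, g) \<in> F \<and> ennreal (4 ^ k) * wnorm q w g < ennreal t \<and> ennreal t < wnorm q w f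
      \<and> wnorm q w f < \<infinity>" for k :: nat
  proof -
    have "\<not> (\<forall>(f, g)\<in>F. wnorm q w f < \<infinity> \<longrightarrow> wnorm q w f \<le> ennreal (4 ^ k) * wnorm q w g)"
    proof
      assume "\<forall>(f, g)\<in>F. wnorm q w f < \<infinity> \<longrightarrow> wnorm q w f \<le> ennreal (4 ^ k) * wnorm q w g"
      moreover have "(0::real) < 4 ^ k" by simp
      ultimately show False using no_const by blast
    qed
    then have "\<exists>(f, g)\<in>F. wnorm q w f < \<infinity> \<and> ennreal (4 ^ k) * wnorm q w g < wnorm q w f"
      by (simp add: not_le case_prod_beta)
    then obtain f g where fg: "(f, g) \<in> F" "wnorm q w f < \<infinity>" "ennreal (4 ^ k) * wnorm q w g < wnorm q w f"
      by blast
    obtain y where y: "ennreal (4 ^ k) * wnorm q w g < y" "y < wnorm q w f"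
      using fg(3) dense by blast
    then obtain t where "y = ennreal t"
      using less_top_ennreal[of y] by (metis less_le_trans top_greatest)
    with fg y show ?thesis by blast
  qed
  then obtain f g t where F: "\<And>k. (f k, g k) \<in> F"
    and g_less: "\<And>k. ennreal (4 ^ k) * wnorm q w (g k) < ennreal (t k)"
    and t_less: "\<And>k. ennreal (t k) < wnorm q w (f k)" and f_fin: "\<And>k. wnorm q w (f k) < \<infinity>"
    by metis
  have [measurable]: "f k \<in> borel_measurable lebesgue" "g k \<in> borel_measurable lebesgue" for k
    using meas[OF F] by auto
  have t: "0 < t k" for k
    using g_less[of k] by (metis ennreal_0 ennreal_neg linorder_not_less not_less_zero)
  have "\<exists>u. u \<in> borel_measurable lebesgue \<and> vnorm ?s u \<le> 1
      \<and> ennreal (t k) \<le> 2 * (\<integral>\<^sup>+x. f k x * w x * u x \<partial>lebesgue)" for k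
  proof (rule vnorm_dual_function[OF q q1 qfin, of "\<lambda>x. f k x * w x" "t k"])
    show "vnorm q (\<lambda>x. f k x * w x) < \<infinity>" "ennreal (t k) < vnorm q (\<lambda>x. f k x * w x)" "0 < t k"
      using f_fin[of k] t_less[of k] t[of k] by (simp_all add: wnorm_def)
  qed (measurable, blast)
  then have "\<exists>u. \<forall>k. u k \<in> borel_measurable lebesgue \<and> vnorm ?s (u k) \<le> 1
      \<and> ennreal (t k) \<le> 2 * (\<integral>\<^sup>+x. f k x * w x * u k x \<partial>lebesgue)"
    by (intro choice) blast
  then obtain u where u [measurable]: "\<And>k. u k \<in> borel_measurable lebesgue"
    and u1: "\<And>k. vnorm ?s (u k) \<le> 1"
    and tu: "\<And>k. ennreal (t k) \<le> 2 * (\<integral>\<^sup>+x. f k x * w x * u k x \<partial>lebesgue)"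
    by blast
  define h where "h x = (\<Sum>k. ennreal ((1 / 2) ^ k) * (w x * u k x))" for x
  have [measurable]: "h \<in> borel_measurable lebesgue"
    unfolding h_def by measurable
  have h_norm: "wnorm ?s ?v h \<le> 2"
  proof -
    have "wnorm ?s ?v h = vnorm ?s (\<lambda>x. \<Sum>k. ennreal ((1 / 2) ^ k) * u k x)"
      unfolding wnorm_def
    proof (intro vnorm_AE_cong)
      show "AE x in lebesgue. h x * inverse (w x) = (\<Sum>k. ennreal ((1 / 2) ^ k) * u k x)"
        using w
      proof eventually_elim
        case (elim x)
        then have 1: "w x * inverse (w x) = 1"
          by (intro ennreal_mult_inverse_self) auto
        have "h x * inverse (w x) = (\<Sum>k. ennreal ((1 / 2) ^ k) * u k x * (w x * inverse (w x)))"
          unfolding h_def by (subst ennreal_suminf_multc[symmetric]) (simp only: mult_ac)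
        then show ?case by (simp only: 1 mult_1_right)
      qed
    qed measurable
    also have "\<dots> \<le> (\<Sum>k. vnorm ?s (\<lambda>x. ennreal ((1 / 2) ^ k) * u k x))"
      by (intro vnorm_suminf_le conj_exponent_in_exponents) measurable
    also have "\<dots> \<le> (\<Sum>k. ennreal ((1 / 2) ^ k) * 1)"
    proof (intro suminf_le)
      fix k
      have "vnorm ?s (\<lambda>x. ennreal ((1 / 2) ^ k) * u k x) \<le> ennreal ((1 / 2) ^ k) * vnorm ?s (u k)"
        by (intro vnorm_cmult_le) auto
      also have "\<dots> \<le> ennreal ((1 / 2) ^ k) * 1"
        using u1 by (intro mult_left_mono) auto
      finally show "vnorm ?s (\<lambda>x. ennreal ((1 / 2) ^ k) * u k x) \<le> ennreal ((1 / 2) ^ k) * 1" .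
    qed auto
    also have "\<dots> = ennreal 2"
      unfolding mult_1_right using geometric_sums[of "1 / 2 :: real"] by (intro suminf_ennreal_eq) auto
    finally show ?thesis by simp
  qed
  obtain K where K: "0 < K" "\<And>f. f \<in> borel_measurable lebesgue \<Longrightarrow> wnorm ?s ?v f < \<infinity> \<Longrightarrow>
      wnorm ?s ?v (ball_maximal f) \<le> ennreal K * wnorm ?s ?v f"
  proof (rule maximal_bounded_onE[OF bounded s])
    show "AE x in lebesgue. 0 < inverse (w x)"
      using w by eventually_elim (auto simp: ennreal_inverse_positive)
  qed auto
  obtain H where H: "H \<in> A1_weights" "\<And>x. h x \<le> H x" "wnorm ?s ?v H \<le> 2 * wnorm ?s ?v h"
    by (rule Rubio_de_Francia_majorant[OF conj_exponent_in_exponents[OF q] _ K])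
       (use h_norm in \<open>auto intro: le_less_trans\<close>)
  have [measurable]: "H \<in> borel_measurable lebesgue"
    using H(1) by (simp add: A1_weights_def)
  have "wnorm ?s ?v H \<le> 2 * 2"
    using H(3) mult_left_mono[OF h_norm, of 2] by (auto intro: order_trans)
  also have "2 * 2 = (4::ennreal)" by simp
  also have "4 < ennreal 5" by (simp flip: ennreal_numeral add: ennreal_less_iff)
  finally have H5: "wnorm ?s ?v H < ennreal 5" .
  obtain C where C: "0 < C" "\<And>k. (\<integral>\<^sup>+x. f k x * H x \<partial>lebesgue) < \<infinity> \<Longrightarrow>
      (\<integral>\<^sup>+x. f k x * H x \<partial>lebesgue) \<le> ennreal C * (\<integral>\<^sup>+x. g k x * H x \<partial>lebesgue)"
    using A1[OF H(1)] F by fastforce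
  have "2 ^ k \<le> 20 * C" for k :: nat
  proof -
    \<comment> \<open>The hypothesis applies only to a finite left-hand side.\<close>
    have "(\<integral>\<^sup>+x. f k x * H x \<partial>lebesgue) < \<infinity>"
    proof -
      obtain m :: nat where "wnorm q w (f k) < of_nat m"
        using f_fin[of k] ennreal_Ex_less_of_nat by auto
      then have "wnorm q w (f k) < ennreal (real m)"
        by (simp add: ennreal_of_nat_eq_real_of_nat)
      then have "(\<integral>\<^sup>+x. f k x * H x \<partial>lebesgue) \<le> ennreal (2 * real m * 5)"
        by (intro nn_integral_mult_weight_le[OF q q1 _ w _ _ _ H5]) auto
      then show ?thesis using le_less_trans by fastforce
    qed
    then have "(\<integral>\<^sup>+x. f k x * H x \<partial>lebesgue) \<le> ennreal C * (\<integral>\<^sup>+x. g k x * H x \<partial>lebesgue)"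
      by (rule C(2))
    also have "\<dots> \<le> ennreal C * ennreal (2 * (t k / 4 ^ k) * 5)"
    proof (intro mult_left_mono nn_integral_mult_weight_le[OF q q1 _ w _ _ _ H5])
      show "wnorm q w (g k) < ennreal (t k / 4 ^ k)"
      proof (rule ccontr)
        assume "\<not> ?thesis"
        then have "ennreal (4 ^ k) * ennreal (t k / 4 ^ k) \<le> ennreal (4 ^ k) * wnorm q w (g k)"
          by (intro mult_left_mono) auto
        then show False
          using g_less[of k] t[of k] by (simp add: ennreal_mult[symmetric])
      qed
    qed auto
    also have "\<dots> = ennreal (10 * C * t k / 4 ^ k)"
      using C t[of k] by (simp add: ennreal_mult[symmetric] mult_ac)
    finally have upper: "(\<integral>\<^sup>+x. f k x * H x \<partial>lebesgue) \<le> ennreal (10 * C * t k / 4 ^ k)" .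
    have "ennreal ((1 / 2) ^ k) * ennreal (t k)
        \<le> ennreal ((1 / 2) ^ k) * (2 * (\<integral>\<^sup>+x. f k x * w x * u k x \<partial>lebesgue))"
      using tu by (intro mult_left_mono) auto
    also have "\<dots> = 2 * (\<integral>\<^sup>+x. f k x * (ennreal ((1 / 2) ^ k) * (w x * u k x)) \<partial>lebesgue)"
    proof -
      have "(\<integral>\<^sup>+x. f k x * (ennreal ((1 / 2) ^ k) * (w x * u k x)) \<partial>lebesgue)
          = (\<integral>\<^sup>+x. ennreal ((1 / 2) ^ k) * (f k x * w x * u k x) \<partial>lebesgue)"
        by (simp only: mult_ac)
      also have "\<dots> = ennreal ((1 / 2) ^ k) * (\<integral>\<^sup>+x. f k x * w x * u k x \<partial>lebesgue)"
        by (rule nn_integral_cmult) measurable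
      finally show ?thesis by (simp only: mult.left_commute[of 2])
    qed
    also have "\<dots> \<le> 2 * (\<integral>\<^sup>+x. f k x * H x \<partial>lebesgue)"
    proof (intro mult_left_mono nn_integral_mono)
      fix x
      have "ennreal ((1 / 2) ^ k) * (w x * u k x) \<le> h x"
        using sum_le_suminf[of "\<lambda>k. ennreal ((1 / 2) ^ k) * (w x * u k x)" "{k}"] by (simp add: h_def)
      also note H(2)
      finally show "ennreal ((1 / 2) ^ k) * (w x * u k x) \<le> H x" .
    qed auto
    also have "\<dots> \<le> 2 * ennreal (10 * C * t k / 4 ^ k)"
      using upper by (intro mult_left_mono) auto
    finally have "ennreal ((1 / 2) ^ k * t k) \<le> ennreal (20 * C * t k / 4 ^ k)"
      using C t[of k] by (simp add: ennreal_mult[symmetric] flip: ennreal_numeral)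
    then have "(1 / 2) ^ k * t k \<le> 20 * C * t k / 4 ^ k"
      using C t[of k] by (subst (asm) ennreal_le_iff) auto
    then have "(1 / 2) ^ k * 4 ^ k \<le> 20 * C"
      using t[of k] by (simp add: field_simps)
    then show ?thesis by (simp add: power_mult_distrib[symmetric])
  qed
  then show False
    using real_arch_pow[of 2 "20 * C"] by (auto simp: not_le[symmetric])
qed

lemma essinf_le_AE: "AE x in M. essinf M f \<le> f x"
proof -
  let ?Z = "{z. AE x in M. z \<le> f x}"
  have "0 \<in> ?Z" by simp
  then have "?Z \<noteq> {}" by blast
  then obtain z :: "nat \<Rightarrow> ennreal" where z: "range z \<subseteq> ?Z" "Sup ?Z = (SUP n. z n)"
    using ennreal_Sup_countable_SUP by metis
  then have "AE x in M. \<forall>n. z n \<le> f x"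
    by (auto simp: AE_all_countable)
  then show ?thesis
    unfolding essinf_eq_AE z by (auto elim!: eventually_mono intro: SUP_least)
qed

text \<open>
  The substitution \<open>t \<mapsto> t\<^sup>a\<close> in the definition of the norm shows that the norm of \<open>f\<^sup>a\<close> for the exponent
  \<open>p/a\<close> is the \<open>a\<close>-th power of the norm of \<open>f\<close> for \<open>p\<close>. Comparison with positive reals expresses this
  without roots of possibly infinite norms.
\<close>

lemma vnorm_epow_less_iff:
  assumes p [measurable]: "p \<in> borel_measurable lebesgue" and pfin: "\<And>x. p x < \<infinity>"
    and f [measurable]: "f \<in> borel_measurable lebesgue" and a: "0 < a" and t: "0 < t"
  shows "vnorm (\<lambda>x. p x / ennreal a) (\<lambda>x. epow (f x) a) < ennreal (t powr a) \<longleftrightarrow> vnorm p f < ennreal t"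
proof -
  let ?q = "\<lambda>x. p x / ennreal a"
  have q [measurable]: "?q \<in> borel_measurable lebesgue" by measurable
  have qfin: "?q x < \<infinity>" for x
    using pfin[of x] a by (auto simp: ennreal_divide_eq_top_iff order.strict_iff_not top_unique)
  have modular: "modular ?q (\<lambda>x. epow (f x) a / ennreal (s powr a)) = modular p (\<lambda>x. f x / ennreal s)"
    if s: "0 < s" for s
  proof -
    have "epow (f x) a / ennreal (s powr a) = epow (f x / ennreal s) a" for x
      using s a by (simp add: divide_ennreal_def inverse_ennreal epow_mult epow_ennreal powr_minus inverse_powr)
    moreover have "a * enn2real (?q x) = enn2real (p x)" for x
      using pfin[of x] a by (cases "p x") (auto simp: divide_ennreal)
    ultimately show ?thesis
      using pfin qfin by (simp add: modular_finite_exponent epow_epow)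
  qed
  show ?thesis
  proof
    assume "vnorm ?q (\<lambda>x. epow (f x) a) < ennreal (t powr a)"
    then obtain r where r: "0 < r" "modular ?q (\<lambda>x. epow (f x) a / ennreal r) \<le> 1" "r < t powr a"
      by (auto simp: vnorm_eq_Inf_modular Inf_less_iff ennreal_less_iff)
    define s where "s = r powr (1 / a)"
    have s: "0 < s" "s powr a = r"
      using r a by (auto simp: s_def powr_powr)
    have "s < t"
      using s r(3) t a by (meson not_less powr_mono2 less_imp_le)
    have "vnorm p f \<le> ennreal s"
      using r(2) s modular[OF s(1)] by (intro vnorm_leI) auto
    also have "\<dots> < ennreal t"
      using s t \<open>s < t\<close> by (simp add: ennreal_less_iff)
    finally show "vnorm p f < ennreal t" .
  next
    assume "vnorm p f < ennreal t"
    then obtain s where s: "0 < s" "modular p (\<lambda>x. f x / ennreal s) \<le> 1" "s < t"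
      by (auto simp: vnorm_eq_Inf_modular Inf_less_iff ennreal_less_iff)
    have "vnorm ?q (\<lambda>x. epow (f x) a) \<le> ennreal (s powr a)"
      using s modular[OF s(1)] by (intro vnorm_leI) auto
    also have "\<dots> < ennreal (t powr a)"
      using s a by (simp add: ennreal_less_iff powr_less_mono2)
    finally show "vnorm ?q (\<lambda>x. epow (f x) a) < ennreal (t powr a)" .
  qed
qed

text \<open>
  For the pairs \<open>(f\<^bsup>p0\<^esup>, g\<^bsup>p0\<^esup>)\<close>, the exponent \<open>p/p0\<close> and the weight \<open>w\<^bsup>p0\<^esup>\<close> this is the preceding
  extrapolation result, and the norms are the \<open>p0\<close>-th powers of the original ones.
\<close>

theorem theorem2p20:
  fixes F :: "((real^'n \<Rightarrow> ennreal) \<times> (real^'n \<Rightarrow> ennreal)) set"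
    and p w :: "real^'n \<Rightarrow> ennreal" and p0 :: real
  assumes "\<And>f g. (f, g) \<in> F \<Longrightarrow> f \<in> borel_measurable lebesgue \<and> g \<in> borel_measurable lebesgue"
    and "p0 > 0"
    and "\<And>w0. w0 \<in> A1_weights \<Longrightarrow>
      \<exists>C>0. \<forall>(f, g)\<in>F. (\<integral>\<^sup>+x. epow (f x) p0 * w0 x \<partial>lebesgue) < \<infinity> \<longrightarrow>
        (\<integral>\<^sup>+x. epow (f x) p0 * w0 x \<partial>lebesgue)
          \<le> ennreal C * (\<integral>\<^sup>+x. epow (g x) p0 * w0 x \<partial>lebesgue)"
    and "p \<in> exponents0"
    and "essinf lebesgue p \<ge> ennreal p0"
    and "w \<in> borel_measurable lebesgue"
    and "(\<lambda>x. epow (w x) p0) \<in> A_weights (\<lambda>x. p x / ennreal p0)"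
    and "maximal_bounded_on (conj_exponent (\<lambda>x. p x / ennreal p0)) (\<lambda>x. inverse (epow (w x) p0))"
  shows "\<exists>C>0. \<forall>(f, g)\<in>F. wnorm p w f < \<infinity> \<longrightarrow> wnorm p w f \<le> ennreal C * wnorm p w g"
proof -
  let ?q = "\<lambda>x. p x / ennreal p0" and ?W = "\<lambda>x. epow (w x) p0"
  let ?F = "(\<lambda>(f, g). (\<lambda>x. epow (f x) p0, \<lambda>x. epow (g x) p0)) ` F"
  note p0 = \<open>p0 > 0\<close> and [measurable] = \<open>w \<in> borel_measurable lebesgue\<close>
  have p [measurable]: "p \<in> borel_measurable lebesgue" and pfin: "p x < \<infinity>" for x
    using \<open>p \<in> exponents0\<close> by (auto simp: exponents0_def)
  have "\<exists>C>0. \<forall>(f, g)\<in>?F. wnorm ?q ?W f < \<infinity> \<longrightarrow> wnorm ?q ?W f \<le> ennreal C * wnorm ?q ?W g"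
  proof (rule extrapolation_from_A1)
    show "f \<in> borel_measurable lebesgue \<and> g \<in> borel_measurable lebesgue" if "(f, g) \<in> ?F" for f g
      using that assms(1) by (auto intro!: borel_measurable_epow)
    show "\<exists>C>0. \<forall>(f, g)\<in>?F. (\<integral>\<^sup>+x. f x * H x \<partial>lebesgue) < \<infinity> \<longrightarrow>
        (\<integral>\<^sup>+x. f x * H x \<partial>lebesgue) \<le> ennreal C * (\<integral>\<^sup>+x. g x * H x \<partial>lebesgue)" if "H \<in> A1_weights" for H
      using assms(3)[OF that] by (auto simp: case_prod_beta)
    show "AE x in lebesgue. 1 \<le> p x / ennreal p0"
      using essinf_le_AE[of lebesgue p]
    proof eventually_elim
      case (elim x)
      then have "ennreal p0 / ennreal p0 \<le> p x / ennreal p0"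
        using assms(5) by (intro divide_right_mono_ennreal) (rule order_trans)
      then show ?case using p0 by (simp add: ennreal_divide_self)
    qed
    show "p x / ennreal p0 < \<infinity>" for x
      using pfin[of x] p0 by (auto simp: ennreal_divide_eq_top_iff order.strict_iff_not top_unique)
    show "AE x in lebesgue. 0 < ?W x \<and> ?W x < \<infinity>"
      using assms(7) by (simp add: A_weights_def)
  qed (use assms in \<open>auto intro!: borel_measurable_epow\<close>)
  then obtain C where C: "0 < C" "\<And>f g. (f, g) \<in> ?F \<Longrightarrow> wnorm ?q ?W f < \<infinity> \<Longrightarrow>
      wnorm ?q ?W f \<le> ennreal C * wnorm ?q ?W g"
    by fastforce
  define C' where "C' = C powr (1 / p0)"
  have C': "0 < C'" "C' powr p0 = C"
    using C p0 by (auto simp: C'_def powr_powr)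
  have less_iff: "wnorm ?q ?W (\<lambda>x. epow (f x) p0) < ennreal (t powr p0) \<longleftrightarrow> wnorm p w f < ennreal t"
    if [measurable]: "f \<in> borel_measurable lebesgue" and "0 < t" for f t
    using vnorm_epow_less_iff[OF p pfin, of "\<lambda>x. f x * w x" p0 t] that p0
    by (simp add: wnorm_def epow_mult)
  have "wnorm p w f \<le> ennreal C' * wnorm p w g" if fg: "(f, g) \<in> F" and fin: "wnorm p w f < \<infinity>" for f g
  proof -
    have [measurable]: "f \<in> borel_measurable lebesgue" "g \<in> borel_measurable lebesgue"
      using assms(1)[OF fg] by auto
    obtain m :: nat where m: "wnorm p w f < of_nat m"
      using fin ennreal_Ex_less_of_nat by auto
    then have "wnorm ?q ?W (\<lambda>x. epow (f x) p0) < ennreal (real m powr p0)"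
      by (subst less_iff) (auto simp: ennreal_of_nat_eq_real_of_nat intro!: Nat.gr0I)
    then have "wnorm ?q ?W (\<lambda>x. epow (f x) p0) < \<infinity>"
      using ennreal_less_top less_trans by fastforce
    with fg have le: "wnorm ?q ?W (\<lambda>x. epow (f x) p0) \<le> ennreal C * wnorm ?q ?W (\<lambda>x. epow (g x) p0)"
      by (intro C) force+
    have "wnorm p w f / ennreal C' \<le> wnorm p w g"
    proof (rule dense_ge)
      fix y assume y: "wnorm p w g < y"
      show "wnorm p w f / ennreal C' \<le> y"
      proof (cases y)
        case (real t)
        then have t: "0 < t" using y by (cases "t = 0") auto
        have "wnorm ?q ?W (\<lambda>x. epow (g x) p0) < ennreal (t powr p0)"
          using y real t by (subst less_iff) auto
        then have "ennreal C * wnorm ?q ?W (\<lambda>x. epow (g x) p0) < ennreal C * ennreal (t powr p0)"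
          using C by (intro ennreal_mult_strict_left_mono) auto
        also have "\<dots> = ennreal ((C' * t) powr p0)"
          using C' t C by (simp add: powr_mult ennreal_mult)
        finally have "wnorm p w f < ennreal (C' * t)"
          using le C' t by (subst less_iff[symmetric]) (auto intro: le_less_trans)
        then show ?thesis
          using real C' by (simp add: ennreal_divide_le_iff ennreal_mult mult.commute)
      qed simp
    qed
    then show ?thesis using C' by (simp add: ennreal_divide_le_iff mult.commute)
  qed
  with C'(1) show ?thesis by auto
qed

end
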